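(* Let $n\ge 4$, $n\not\equiv 2\pmod 4$, and put $k=\lfloor n/2\rfloor$. The number of facets of $P_{\mathrm{QTSASM}(n)}$ is at least $$\mathrm{Cat}_{k-1}-1=\frac1k\binom{2k-2}{k-1}-1.$$ Consequently, the number of facets of $P_{\mathrm{QTSASM}(n)}$ is at least $$\frac{4^{k-1}}{k(2k-1)}-1\ \ge\ \frac{2^{n-3}}{n^2}-1,$$ and is therefore $2^{\Omega(n)}$ as $n\to\infty$ with $n\not\equiv 2\pmod 4$.
   Context: An $n\times n$ alternating sign matrix (ASM) is an $n\times n$ matrix with entries in $\{0,1,-1\}$ such that in each row and each column the non-zero entries alternate in sign and the first and last non-zero entries are $1$ (so every row and column sums to $1$). A QTSASM (quarter-turn symmetric ASM) is an $n\times n$ ASM $X$ with $x_{i,j}=x_{j,n+1-i}$ for all $i,j\in\{1,\dots,n\}$. $P_{\mathrm{QTSASM}(n)}\subseteq\mathbb R^{n\times n}$ is the convex hull of all $n\times n$ QTSASMs. $\mathrm{Cat}_r=\frac{1}{r+1}\binom{2r}{r}$ is the $r$-th Catalan number. A facet of a polytope $P$ is a face of dimension $\dim P-1$. *)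

theory Defs
  imports "HOL-Analysis.Analysis" "HOL-Analysis.Finite_Function_Topology"
begin

text \<open>
  The size \<open>n\<close> has to vary inside the statement (it contains an asymptotic claim), so an
  \<open>n \<times> n\<close> real matrix is a finitely supported function on \<open>nat \<times> nat\<close> whose support lies in
  \<open>{1..n} \<times> {1..n}\<close>. For fixed \<open>n\<close> these form a linear subspace isomorphic to the space of
  \<open>n \<times> n\<close> matrices, and the real vector space structure of the type provides
  \<open>convex hull\<close> and \<open>face_of\<close>.
\<close>

type_synonym real_matrix = "(nat \<times> nat) \<Rightarrow>\<^sub>0 real"

abbreviation entry :: "real_matrix \<Rightarrow> nat \<Rightarrow> nat \<Rightarrow> real" where
  "entry X i j \<equiv> Poly_Mapping.lookup X (i, j)"

definition is_matrix :: "nat \<Rightarrow> real_matrix \<Rightarrow> bool" where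
  "is_matrix n X \<longleftrightarrow> Poly_Mapping.keys X \<subseteq> {1..n} \<times> {1..n}"

definition nonzero_entries :: "real list \<Rightarrow> real list" where
  "nonzero_entries xs = filter (\<lambda>x. x \<noteq> 0) xs"

definition alternating_line :: "real list \<Rightarrow> bool" where
  "alternating_line xs \<longleftrightarrow>
     successively (\<lambda>a b. sgn b = - sgn a) (nonzero_entries xs) \<and>
     nonzero_entries xs \<noteq> [] \<and>
     hd (nonzero_entries xs) = 1 \<and> last (nonzero_entries xs) = 1"

definition ASM :: "nat \<Rightarrow> real_matrix set" where
  "ASM n = {X. is_matrix n X \<and>
     (\<forall>i\<in>{1..n}. \<forall>j\<in>{1..n}. entry X i j \<in> {0, 1, -1}) \<and>
     (\<forall>i\<in>{1..n}. alternating_line (map (\<lambda>j. entry X i j) [1..<Suc n])) \<and>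
     (\<forall>j\<in>{1..n}. alternating_line (map (\<lambda>i. entry X i j) [1..<Suc n]))}"

definition QTSASM :: "nat \<Rightarrow> real_matrix set" where
  "QTSASM n = {X \<in> ASM n. \<forall>i\<in>{1..n}. \<forall>j\<in>{1..n}. entry X i j = entry X j (n + 1 - i)}"

definition P_QTSASM :: "nat \<Rightarrow> real_matrix set" where
  "P_QTSASM n = convex hull (QTSASM n)"

text \<open>
  The library's \<open>aff_dim\<close> and \<open>facet_of\<close> are restricted to Euclidean spaces. The following are
  the same notions for arbitrary real vector spaces (for sets spanning a finite-dimensional
  affine subspace): the dimension of a nonempty set is the dimension of the linear space parallel
  to its affine hull. On Euclidean spaces they agree with the library notions, as shown below.
\<close>

definition affine_dimension :: "'a::real_vector set \<Rightarrow> int" where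
  "affine_dimension S =
     (if S = {} then -1 else int (dim {x - y |x y. x \<in> S \<and> y \<in> S}))"

definition is_facet_of :: "'a::real_vector set \<Rightarrow> 'a set \<Rightarrow> bool" where
  "is_facet_of F S \<longleftrightarrow>
     F face_of S \<and> F \<noteq> {} \<and> affine_dimension F = affine_dimension S - 1"

lemma affine_dimension_eq_aff_dim:
  fixes S :: "'a::euclidean_space set"
  shows "affine_dimension S = aff_dim S"
proof (cases "S = {}")
  case True
  then show ?thesis by (simp add: affine_dimension_def)
next
  case False
  then obtain a where a: "a \<in> S" by blast
  let ?D = "{x - y |x y. x \<in> S \<and> y \<in> S}"
  let ?T = "(\<lambda>x. - a + x) ` S"
  have "?D \<subseteq> span ?T"
  proof
    fix z assume "z \<in> ?D"
    then obtain x y where z: "z = x - y" and "x \<in> S" "y \<in> S" by blast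
    then have "(- a + x) - (- a + y) \<in> span ?T"
      by (intro span_diff span_base) auto
    then show "z \<in> span ?T" using z by simp
  qed
  moreover have "?T \<subseteq> ?D"
  proof
    fix z assume "z \<in> ?T"
    then obtain x where "x \<in> S" "z = x - a" by auto
    then show "z \<in> ?D" using a by blast
  qed
  ultimately have "dim ?D = dim ?T"
    using dim_subset[of ?D "span ?T"] dim_subset[of ?T ?D] by (simp only: dim_span order_antisym)
  moreover have "aff_dim S = int (dim ?T)"
    by (rule aff_dim_eq_dim) (simp add: a hull_inc)
  ultimately show ?thesis using False by (simp add: affine_dimension_def)
qed

lemma is_facet_of_iff_facet_of:
  fixes S :: "'a::euclidean_space set"
  shows "is_facet_of F S \<longleftrightarrow> F facet_of S"
  by (simp add: is_facet_of_def facet_of_def affine_dimension_eq_aff_dim)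

definition num_facets :: "'a::real_vector set \<Rightarrow> nat" where
  "num_facets P = card {F. is_facet_of F P}"

definition Cat :: "nat \<Rightarrow> real" where
  "Cat r = 1 / (real r + 1) * real ((2 * r) choose r)"

end

theory Submission
  imports Defs "HOL-Real_Asymp.Real_Asymp"
begin

text \<open>
  Let \<open>k = \<lfloor>n/2\<rfloor>\<close>. For every Young diagram \<open>A\<close> of cells \<open>(i, j)\<close> with \<open>i, j \<ge> 2\<close> and
  \<open>i + j \<le> k + 1\<close>, the sum of the entries in \<open>A\<close> is nonnegative on all QTSASMs. The number of
  these diagrams, including the empty one, is \<open>Cat (k - 1)\<close>. For nonempty \<open>A\<close> choose a facet that
  contains all QTSASMs with sum \<open>0\<close> over \<open>A\<close>, but not a fixed QTSASM whose only nonzero entry in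
  the staircase is a 1 in the corner \<open>(2, 2)\<close>. Call two cells linked by a QTSASM which
  has a 1 in the one, a \<open>-1\<close> in the other and is zero elsewhere in the staircase: it lies on
  the facet if \<open>A\<close> contains both cells. Linear relations between such QTSASMs, those with a single
  nonzero entry in the staircase and those vanishing there show that, conversely, cells outside
  \<open>A\<close> linked to a cell of \<open>A\<close> have their link off the facet. All cells are linked to the corner
  through the second column, so the facet determines \<open>A\<close>.
\<close>

section \<open>Facets of polytopes in real vector spaces\<close>

text \<open>If \<open>v\<close> has positive weight in a convex combination equal to
  \<open>x\<close>, then \<open>x\<close> is \<open>v\<close> itself or lies in the open segment
  from \<open>v\<close> to the rescaled remainder. So a face containing \<open>x\<close> contains
  every such \<open>v\<close>.\<close>

lemma face_of_convex_hull_finite: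
  fixes V :: "'a::real_vector set"
  assumes "finite V" and F: "F face_of convex hull V"
  shows "F = convex hull (F \<inter> V)"
proof
  have "convex F" using F by (simp add: face_of_def)
  then show "convex hull (F \<inter> V) \<subseteq> F" by (simp add: hull_minimal)
next
  show "F \<subseteq> convex hull (F \<inter> V)"
  proof
    fix x assume x: "x \<in> F"
    then have "x \<in> convex hull V" using F by (auto simp: face_of_def)
    then obtain u where u: "\<And>v. v \<in> V \<Longrightarrow> 0 \<le> u v" "sum u V = 1" "(\<Sum>v\<in>V. u v *\<^sub>R v) = x"
      unfolding convex_hull_finite[OF \<open>finite V\<close>] by blast
    have in_F: "v \<in> F" if v: "v \<in> V" "u v \<noteq> 0" for v
    proof (cases "u v = 1")
      case True
      have "sum u (V - {v}) = 0"
        using sum.remove[OF \<open>finite V\<close> v(1), of u] u(2) True by simp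
      then have "u t = 0" if "t \<in> V - {v}" for t
        using that u(1) sum_nonneg_eq_0_iff[of "V - {v}" u] \<open>finite V\<close> by auto
      then have "(\<Sum>t\<in>V. u t *\<^sub>R t) = v"
        using sum.remove[OF \<open>finite V\<close> v(1), of "\<lambda>t. u t *\<^sub>R t"] True by simp
      then show ?thesis using u(3) x by simp
    next
      case False
      define s where "s = sum u (V - {v})"
      have s: "s = 1 - u v"
        using sum.remove[OF \<open>finite V\<close> v(1), of u] u(2) by (simp add: s_def)
      have "s \<ge> 0" unfolding s_def by (rule sum_nonneg) (use u(1) in auto)
      then have spos: "s > 0" using s False by linarith
      define y where "y = (\<Sum>t\<in>V - {v}. (u t / s) *\<^sub>R t)"
      have y: "y \<in> convex hull V"
        unfolding y_def
        by (rule convex_sum)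
          (use \<open>finite V\<close> u(1) spos in \<open>auto simp: hull_inc s_def[symmetric] simp flip: sum_divide_distrib\<close>)
      have "s *\<^sub>R y = (\<Sum>t\<in>V - {v}. u t *\<^sub>R t)"
        using spos by (simp add: y_def scaleR_sum_right)
      then have x': "x = u v *\<^sub>R v + s *\<^sub>R y"
        using sum.remove[OF \<open>finite V\<close> v(1), of "\<lambda>t. u t *\<^sub>R t"] u(3) by simp
      show ?thesis
      proof (cases "v = y")
        case True
        then have "x = v" using x' s by (simp flip: scaleR_left_distrib)
        then show ?thesis using x by simp
      next
        case neq: False
        have "x \<in> open_segment v y"
          unfolding in_segment(2)
          by (intro conjI exI[of _ s]) (use neq x' s spos u(1)[OF v(1)] v(2) in auto)
        then show ?thesis
          using F x y v(1) by (auto simp: face_of_def intro: hull_inc)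
      qed
    qed
    have "(\<Sum>v\<in>V. u v *\<^sub>R v) = (\<Sum>v\<in>F \<inter> V. u v *\<^sub>R v)" "sum u V = sum u (F \<inter> V)"
      using in_F \<open>finite V\<close> by (auto intro!: sum.mono_neutral_right)
    then have "x = (\<Sum>v\<in>F \<inter> V. u v *\<^sub>R v)" "sum u (F \<inter> V) = 1"
      using u by auto
    moreover have "(\<Sum>v\<in>F \<inter> V. u v *\<^sub>R v) \<in> convex hull (F \<inter> V)"
      by (rule convex_sum) (use \<open>finite V\<close> u(1) \<open>sum u (F \<inter> V) = 1\<close> in \<open>auto simp: hull_inc\<close>)
    ultimately show "x \<in> convex hull (F \<inter> V)" by simp
  qed
qed

text \<open>A facet is recovered from the points of \<open>V\<close> in it. Since
  \<open>card\<close> is 0 on infinite sets, \<open>num_facets\<close> can only be bounded below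
  once this is known.\<close>

lemma finite_facets_convex_hull:
  fixes V :: "'a::real_vector set"
  assumes "finite V"
  shows "finite {F. is_facet_of F (convex hull V)}"
proof (rule finite_subset)
  show "{F. is_facet_of F (convex hull V)} \<subseteq> (hull) convex ` Pow V"
  proof clarify
    fix F assume "is_facet_of F (convex hull V)"
    then have "F = convex hull (F \<inter> V)"
      using face_of_convex_hull_finite[OF assms] by (simp add: is_facet_of_def)
    then show "F \<in> (hull) convex ` Pow V" by (rule image_eqI) simp
  qed
  show "finite ((hull) convex ` Pow V)" using assms by simp
qed

lemma linear_ge_on_convex_hull:
  fixes g :: "'a::real_vector \<Rightarrow> real"
  assumes "linear g" "\<And>v. v \<in> V \<Longrightarrow> c \<le> g v" "x \<in> convex hull V"
  shows "c \<le> g x"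
proof -
  have "convex {x. c \<le> g x}"
    using assms(1) convex_linear_vimage[of g "{c..}"] by (simp add: vimage_def)
  then have "convex hull V \<subseteq> {x. c \<le> g x}"
    using assms(2) by (intro hull_minimal) auto
  then show ?thesis using assms(3) by auto
qed

lemma face_of_linear_minimum:
  fixes g :: "'a::real_vector \<Rightarrow> real"
  assumes g: "linear g" and ge: "\<And>x. x \<in> S \<Longrightarrow> c \<le> g x" and "convex S"
  shows "{x \<in> S. g x = c} face_of S"
proof -
  have "convex {x. g x = c}"
    using g convex_linear_vimage[of g "{c}"] by (simp add: vimage_def)
  then have "convex {x \<in> S. g x = c}"
    using \<open>convex S\<close> convex_Int[of S "{x. g x = c}"] by (simp add: Int_def)
  moreover have "g a = c \<and> g b = c"
    if ab: "a \<in> S" "b \<in> S" and x: "g x = c" "x \<in> open_segment a b" for a b x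
  proof -
    from x(2) obtain t where t: "0 < t" "t < 1" "x = (1 - t) *\<^sub>R a + t *\<^sub>R b"
      by (auto simp: in_segment)
    have "g x = (1 - t) * g a + t * g b"
      unfolding t(3) by (simp add: linear_add[OF g] linear_scale[OF g])
    then have eq: "(1 - t) * (g a - c) + t * (g b - c) = 0"
      using x(1) by (simp add: algebra_simps)
    have "(1 - t) * (g a - c) \<ge> 0" "t * (g b - c) \<ge> 0"
      using t ge ab by auto
    then have "(1 - t) * (g a - c) = 0" "t * (g b - c) = 0" using eq by linarith+
    then show ?thesis using t by auto
  qed
  ultimately show ?thesis unfolding face_of_def by blast
qed

lemma affine_dimension_eqI:
  fixes S :: "'a::real_vector set"
  assumes "a \<in> S" "independent B" "B \<subseteq> {x - y |x y. x \<in> S \<and> y \<in> S}"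
    and "\<And>x. x \<in> S \<Longrightarrow> x - a \<in> span B"
  shows "affine_dimension S = int (card B)"
proof -
  have "{x - y |x y. x \<in> S \<and> y \<in> S} \<subseteq> span B"
  proof clarify
    fix x y assume "x \<in> S" "y \<in> S"
    then have "(x - a) - (y - a) \<in> span B" using assms(4) by (blast intro: span_diff)
    then show "x - y \<in> span B" by simp
  qed
  then have "dim {x - y |x y. x \<in> S \<and> y \<in> S} = card B"
    using assms by (intro dim_unique) auto
  then show ?thesis using assms(1) by (auto simp: affine_dimension_def)
qed

lemma linear_functional_separating_span:
  fixes x :: "'a::real_vector"
  assumes "x \<notin> span S"
  obtains h :: "'a \<Rightarrow> real" where "linear h" "\<And>y. y \<in> span S \<Longrightarrow> h y = 0" "h x = 1"
proof -
  obtain B where B: "B \<subseteq> S" "independent B" "S \<subseteq> span B"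
    using maximal_independent_subset .
  have "span S = span B" using B by (metis span_mono span_span subset_antisym)
  then have x: "x \<notin> span B" using assms by simp
  then have "independent (insert x B)" using B by (simp add: independent_insert)
  then obtain h :: "'a \<Rightarrow> real" where h: "linear h" "\<forall>y\<in>insert x B. h y = (if y = x then 1 else 0)"
    using linear_independent_extend[of "insert x B" "\<lambda>y. if y = x then 1 else 0"] by auto
  have "h y = 0" if "y \<in> B" for y
    using h(2) that x span_base[of y B] by (metis insertCI)
  then have "h y = 0" if "y \<in> span B" for y
    using linear_eq_0_on_span[OF h(1)] that by blast
  then show ?thesis using that[of h] h \<open>span S = span B\<close> by auto
qed

text \<open>
  Among all supporting functionals that vanish on the given tight points and not at \<open>w\<close>, one with
  the most tight points defines a facet: otherwise it could be tilted, without changing its values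
  at \<open>w\<close> and the tight points, until a further point of \<open>V\<close> becomes tight.
\<close>
lemma facet_through_tight_points:
  fixes f :: "'a::real_vector \<Rightarrow> real"
  assumes V: "finite V" and f: "linear f" "\<And>v. v \<in> V \<Longrightarrow> b \<le> f v"
    and v0: "v0 \<in> V" "f v0 = b" and w: "w \<in> V" "b < f w"
  obtains g :: "'a \<Rightarrow> real" and c where "linear g" "\<And>v. v \<in> V \<Longrightarrow> c \<le> g v"
    "\<And>v. v \<in> V \<Longrightarrow> f v = b \<Longrightarrow> g v = c" "c < g w"
    "is_facet_of {x \<in> convex hull V. g x = c} (convex hull V)"
proof -
  \<comment> \<open>The maximisation runs over pairs, because tilting a functional changes its
    minimum as well.\<close>
  define good where "good = (\<lambda>(g :: 'a \<Rightarrow> real, c). linear g \<and> (\<forall>v\<in>V. c \<le> g v) \<and>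
    (\<forall>v\<in>V. f v = b \<longrightarrow> g v = c) \<and> c < g w)"
  define tight where "tight = (\<lambda>(g :: 'a \<Rightarrow> real, c). {v \<in> V. g v = c})"
  have "good (f, b)" using f w by (auto simp: good_def)
  moreover have "\<forall>p. good p \<longrightarrow> card (tight p) < Suc (card V)"
    using V by (auto simp: tight_def less_Suc_eq_le intro!: card_mono)
  ultimately obtain p where p: "good p" and max: "\<And>q. good q \<Longrightarrow> card (tight q) \<le> card (tight p)"
    using ex_has_greatest_nat[of good "(f, b)" "\<lambda>p. card (tight p)" "Suc (card V)"] by (metis less_imp_le)
  obtain g c where gc: "p = (g, c)" by (cases p)
  have g: "linear g" "\<And>v. v \<in> V \<Longrightarrow> c \<le> g v" "\<And>v. v \<in> V \<Longrightarrow> f v = b \<Longrightarrow> g v = c" "c < g w"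
    using p by (auto simp: good_def gc)
  define T where "T = {v \<in> V. g v = c}"
  have v0T: "v0 \<in> T" using v0 g by (simp add: T_def)
  define D where "D = (\<lambda>v. v - v0) ` T"
  \<comment> \<open>Maximality enters here: the tight directions together with the single direction
    \<open>w - v0\<close> span all directions of \<open>V\<close>.\<close>
  have span: "v - v0 \<in> span (insert (w - v0) D)" if "v \<in> V" for v
  proof (rule ccontr)
    assume "v - v0 \<notin> span (insert (w - v0) D)"
    then obtain h0 :: "'a \<Rightarrow> real" where h0: "linear h0"
      "\<And>y. y \<in> span (insert (w - v0) D) \<Longrightarrow> h0 y = 0" "h0 (v - v0) = 1"
      by (rule linear_functional_separating_span) blast
    define h where "h = (\<lambda>x. h0 (x - v0))"
    have hT: "h x = 0" if "x \<in> T" for x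
      using that unfolding h_def by (intro h0(2) span_base) (auto simp: D_def)
    have hw: "h w = 0" unfolding h_def by (intro h0(2) span_base) auto
    have hv: "h v = 1" by (simp add: h_def h0(3))
    define N where "N = {x \<in> V. h x > 0}"
    define r where "r = (\<lambda>x. (g x - c) / h x)"
    have "finite N" "v \<in> N" using V \<open>v \<in> V\<close> hv by (auto simp: N_def)
    then obtain z where z: "z \<in> N" "\<And>x. x \<in> N \<Longrightarrow> r z \<le> r x"
      using ex_is_arg_min_if_finite[of N r] unfolding is_arg_min_linorder by auto
    \<comment> \<open>The largest tilt along \<open>h0\<close> that keeps all of \<open>V\<close> on
      the right side. It makes \<open>z\<close> tight, and \<open>z\<close> is new because
      \<open>h\<close> vanishes on \<open>T\<close>.\<close>
    define t where "t = r z"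
    have tpos: "t \<ge> 0" using z(1) g(2) by (auto simp: t_def r_def N_def)
    define g' where "g' = (\<lambda>x. g x - t * h0 x)"
    define c' where "c' = c - t * h0 v0"
    have g'c': "g' x - c' = (g x - c) - t * h x" for x
      by (simp add: g'_def c'_def h_def linear_diff[OF h0(1)] algebra_simps)
    have nonneg: "c' \<le> g' x" if "x \<in> V" for x
    proof (cases "h x > 0")
      case True
      then have "t * h x \<le> r x * h x"
        using z(2)[of x] that by (intro mult_right_mono) (auto simp: N_def t_def)
      also have "\<dots> = g x - c" using True by (simp add: r_def)
      finally show ?thesis using g'c'[of x] by simp
    next
      case False
      then have "t * h x \<le> 0" using tpos by (simp add: mult_nonneg_nonpos)
      then show ?thesis using g'c'[of x] g(2)[OF that] by linarith
    qed
    have "linear g'"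
      unfolding g'_def by (intro linear_compose_sub g(1) linear_compose[OF h0(1), of "\<lambda>y. t * y", unfolded o_def])
        (simp add: linear_times)
    moreover have "g' x = c'" if "x \<in> T" for x
      using g'c'[of x] hT[OF that] that by (simp add: T_def)
    moreover have "c' < g' w" using g'c'[of w] hw g(4) by simp
    ultimately have "good (g', c')"
      using nonneg g(3) by (auto simp: good_def T_def)
    from max[OF this] have "card (tight (g', c')) \<le> card T" by (simp add: gc T_def tight_def)
    moreover have "insert z T \<subseteq> tight (g', c')"
      using \<open>\<And>x. x \<in> T \<Longrightarrow> g' x = c'\<close> z(1) g'c'[of z]
      by (auto simp: tight_def T_def N_def t_def r_def)
    moreover have "finite (tight (g', c'))" using V by (simp add: tight_def)
    moreover have "z \<notin> T" using z(1) hT by (auto simp: N_def)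
    moreover have "finite T" using V by (simp add: T_def)
    ultimately show False
      using card_mono[of "tight (g', c')" "insert z T"] by simp
  qed
  define P where "P = convex hull V"
  define F where "F = {x \<in> P. g x = c}"
  have VP: "V \<subseteq> P" by (simp add: P_def hull_subset)
  obtain B where B: "B \<subseteq> D" "independent B" "D \<subseteq> span B"
    using maximal_independent_subset .
  have TF: "T \<subseteq> F" by (auto simp: T_def F_def P_def hull_inc)
  have gspan: "g y = 0" if "y \<in> span D" for y
    using that g(1) by (rule linear_eq_0_on_span[rotated -1])
      (auto simp: D_def T_def linear_diff[OF g(1)] v0T[unfolded T_def, simplified])
  have face: "F face_of P"
    unfolding F_def P_def
    by (rule face_of_linear_minimum) (auto simp: g(1) intro: linear_ge_on_convex_hull[OF g(1,2)])
  have "F = convex hull (F \<inter> V)"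
    using face_of_convex_hull_finite[OF V] face by (simp add: P_def)
  moreover have "F \<inter> V = T" by (auto simp: F_def T_def P_def hull_inc)
  ultimately have FT: "F = convex hull T" by simp
  have hull_span: "x - v0 \<in> span A" if "x \<in> convex hull U" "\<And>v. v \<in> U \<Longrightarrow> v - v0 \<in> span A" for x U A
  proof -
    have "convex ((\<lambda>x. x - v0) -` span A)"
    proof -
      have "(\<lambda>x. x - v0) -` span A = (\<lambda>x. v0 + x) ` span A" by (auto simp: image_iff) (metis add.commute diff_add_cancel)
      then show ?thesis by (simp add: convex_translation subspace_imp_convex)
    qed
    then have "convex hull U \<subseteq> (\<lambda>x. x - v0) -` span A" using that(2) by (intro hull_minimal) auto
    then show ?thesis using that(1) by auto
  qed
  have spanB: "span D = span B" using B by (metis span_mono span_span subset_antisym)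
  have "finite B" using B(1) V finite_subset by (fastforce simp: D_def T_def)
  \<comment> \<open>\<open>g\<close> vanishes on the tight directions but not on
    \<open>w - v0\<close>, so the codimension is exactly one.\<close>
  have wB: "w - v0 \<notin> span B"
    using gspan[of "w - v0"] g(4) v0T by (auto simp: spanB linear_diff[OF g(1)] T_def)
  have dF: "affine_dimension F = int (card B)"
  proof (rule affine_dimension_eqI[of v0])
    show "v0 \<in> F" using v0T TF by auto
    show "B \<subseteq> {x - y |x y. x \<in> F \<and> y \<in> F}"
      using B(1) TF v0T unfolding D_def by blast
    fix x assume "x \<in> F"
    then show "x - v0 \<in> span B"
      unfolding FT by (rule hull_span) (use B(3) in \<open>auto simp: D_def\<close>)
  qed (rule B)
  have dP: "affine_dimension P = int (card (insert (w - v0) B))"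
  proof (rule affine_dimension_eqI[of v0])
    show "v0 \<in> P" using v0 by (auto simp: P_def hull_inc)
    show "independent (insert (w - v0) B)"
      using wB B(2) by (simp add: independent_insert)
    show "insert (w - v0) B \<subseteq> {x - y |x y. x \<in> P \<and> y \<in> P}"
      using B(1) VP v0 w unfolding D_def T_def by blast
    fix x assume "x \<in> P"
    then show "x - v0 \<in> span (insert (w - v0) B)"
      unfolding P_def
    proof (rule hull_span)
      fix v assume "v \<in> V"
      have "insert (w - v0) D \<subseteq> span (insert (w - v0) B)"
        using B(3) span_mono[of B "insert (w - v0) B"] by (auto intro: span_base)
      then have "span (insert (w - v0) D) \<subseteq> span (insert (w - v0) B)"
        by (rule span_minimal) simp
      then show "v - v0 \<in> span (insert (w - v0) B)" using span[OF \<open>v \<in> V\<close>] by auto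
    qed
  qed
  have "card (insert (w - v0) B) = Suc (card B)"
    using wB \<open>finite B\<close> span_base[of "w - v0" B] by (metis card_insert_disjoint)
  then have "is_facet_of F P"
    using face dF dP v0T TF by (auto simp: is_facet_of_def)
  then show ?thesis using that[of g c] g by (simp add: F_def P_def)
qed

section \<open>Unfolding a quarter to a quarter-turn symmetric matrix\<close>

lemma alternating_line_if_prefix_sums:
  assumes "\<And>m. m \<le> length xs \<Longrightarrow> sum_list (take m xs) \<in> {0, 1}" "sum_list xs = 1"
  shows "alternating_line xs"
proof -
  \<comment> \<open>Generalised to a line entered with sum \<open>p\<close> of the earlier entries:
    the next nonzero entry is \<open>1 - 2 * p\<close>, that is 1 for \<open>p = 0\<close> and -1
    for \<open>p = 1\<close>, and \<open>p = 1\<close> if none is left.\<close>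
  have "successively (\<lambda>a b. sgn b = - sgn a) (nonzero_entries xs) \<and>
      (if nonzero_entries xs = [] then p = 1
       else hd (nonzero_entries xs) = 1 - 2 * p \<and> last (nonzero_entries xs) = 1)"
    if "\<forall>m\<le>length xs. p + sum_list (take m xs) \<in> {0, 1}" "p + sum_list xs = 1" for p
    using that
  proof (induction xs arbitrary: p)
    case Nil
    then show ?case by (simp add: nonzero_entries_def)
  next
    case (Cons x xs)
    have p: "p \<in> {0, 1}" using Cons.prems(1)[rule_format, of 0] by simp
    have px: "p + x \<in> {0, 1}" using Cons.prems(1)[rule_format, of 1] by simp
    have "\<forall>m\<le>length xs. (p + x) + sum_list (take m xs) \<in> {0, 1}"
    proof (intro allI impI)
      fix m assume "m \<le> length xs"
      then show "(p + x) + sum_list (take m xs) \<in> {0, 1}"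
        using Cons.prems(1)[rule_format, of "Suc m"] by (simp add: add.assoc)
    qed
    moreover have "(p + x) + sum_list xs = 1" using Cons.prems(2) by simp
    ultimately have IH: "successively (\<lambda>a b. sgn b = - sgn a) (nonzero_entries xs) \<and>
      (if nonzero_entries xs = [] then p + x = 1
       else hd (nonzero_entries xs) = 1 - 2 * (p + x) \<and> last (nonzero_entries xs) = 1)"
      by (rule Cons.IH)
    show ?case
    proof (cases "x = 0")
      case True
      then have "nonzero_entries (x # xs) = nonzero_entries xs"
        by (simp add: nonzero_entries_def)
      then show ?thesis using IH True by (auto split: if_splits)
    next
      case False
      then have "nonzero_entries (x # xs) = x # nonzero_entries xs"
        by (simp add: nonzero_entries_def)
      then show ?thesis
        using IH p px False by (auto simp: successively_Cons split: if_splits)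
    qed
  qed
  from this[of 0] assms show ?thesis by (auto simp: alternating_line_def split: if_splits)
qed

lemma alternating_line_prefix_sums:
  assumes "alternating_line xs" "set xs \<subseteq> {0, 1, -1}"
  shows "m \<le> length xs \<Longrightarrow> sum_list (take m xs) \<in> {0, 1}" "sum_list xs = 1"
proof -
  have "(\<forall>m\<le>length xs. p + sum_list (take m xs) \<in> {0, 1}) \<and> p + sum_list xs = 1"
    if "successively (\<lambda>a b. sgn b = - sgn a) (nonzero_entries xs)"
      "set xs \<subseteq> {0, 1, -1}" "p \<in> {0, 1}"
      "if nonzero_entries xs = [] then p = 1
       else hd (nonzero_entries xs) = 1 - 2 * p \<and> last (nonzero_entries xs) = 1" for p
    using that
  proof (induction xs arbitrary: p)
    case Nil
    then show ?case by (simp add: nonzero_entries_def)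
  next
    case (Cons x xs)
    have "(\<forall>m\<le>length xs. (p + x) + sum_list (take m xs) \<in> {0, 1}) \<and> (p + x) + sum_list xs = 1"
    proof (cases "x = 0")
      case True
      then have "nonzero_entries (x # xs) = nonzero_entries xs"
        by (simp add: nonzero_entries_def)
      then show ?thesis
        using Cons.IH[of p] Cons.prems by (simp only: True add_0_right) simp
    next
      case False
      then have nz: "nonzero_entries (x # xs) = x # nonzero_entries xs"
        by (simp add: nonzero_entries_def)
      show ?thesis
      proof (rule Cons.IH)
        show "successively (\<lambda>a b. sgn b = - sgn a) (nonzero_entries xs)"
          using Cons.prems(1) by (auto simp: nz successively_Cons)
        have x: "x = 1 - 2 * p" using Cons.prems(4) nz by simp
        then show "p + x \<in> {0, 1}" using Cons.prems(3) by auto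
        show "if nonzero_entries xs = [] then p + x = 1
          else hd (nonzero_entries xs) = 1 - 2 * (p + x) \<and> last (nonzero_entries xs) = 1"
        proof (cases "nonzero_entries xs = []")
          case True
          then show ?thesis using Cons.prems(3,4) nz x by auto
        next
          case False
          then have "hd (nonzero_entries xs) \<in> set xs"
            using hd_in_set[of "nonzero_entries xs"] by (auto simp: nonzero_entries_def)
          then have "hd (nonzero_entries xs) \<in> {0, 1, -1}" using Cons.prems(2) by auto
          moreover have "sgn (hd (nonzero_entries xs)) = - sgn x"
            using Cons.prems(1) False by (simp add: nz successively_Cons)
          ultimately show ?thesis
            using False Cons.prems(3,4) nz x by (auto simp: sgn_if split: if_splits)
        qed
      qed (use Cons.prems in auto)
    qed
    then show ?case
      using Cons.prems(3) by (auto simp: take_Cons' add.assoc)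
  qed
  from this[of 0] assms
  have *: "(\<forall>m\<le>length xs. sum_list (take m xs) \<in> {0, 1}) \<and> sum_list xs = 1"
    by (simp add: alternating_line_def)
  show "m \<le> length xs \<Longrightarrow> sum_list (take m xs) \<in> {0, 1}" "sum_list xs = 1"
    using * by auto
qed

lemma sum_list_take_map_upt:
  fixes f :: "nat \<Rightarrow> real"
  assumes "m \<le> n"
  shows "sum_list (take m (map f [1..<Suc n])) = sum f {1..m}"
proof -
  have "take m (map f [1..<Suc n]) = map f [1..<Suc m]"
    using assms by (auto simp: take_map simp del: upt_Suc)
  then show ?thesis
    by (simp only: interv_sum_list_conv_sum_set_nat set_upt atLeastLessThanSuc_atLeastAtMost)
qed

lemma alternating_line_map_if_prefix_sums:
  fixes f :: "nat \<Rightarrow> real"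
  assumes "\<And>m. m \<le> n \<Longrightarrow> sum f {1..m} \<in> {0, 1}" "sum f {1..n} = 1"
  shows "alternating_line (map f [1..<Suc n])"
proof (rule alternating_line_if_prefix_sums)
  fix m assume "m \<le> length (map f [1..<Suc n])"
  then show "sum_list (take m (map f [1..<Suc n])) \<in> {0, 1}"
    using assms(1)[of m] sum_list_take_map_upt[of m n f] by (simp del: upt_Suc)
next
  show "sum_list (map f [1..<Suc n]) = 1"
    using assms(2) sum_list_take_map_upt[of n n f] by (simp del: upt_Suc)
qed

lemma alternating_line_map_prefix_sums:
  fixes f :: "nat \<Rightarrow> real"
  assumes "alternating_line (map f [1..<Suc n])" "\<And>j. j \<in> {1..n} \<Longrightarrow> f j \<in> {0, 1, -1}"
  shows "m \<le> n \<Longrightarrow> sum f {1..m} \<in> {0, 1}" "sum f {1..n} = 1"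
proof -
  have "set (map f [1..<Suc n]) \<subseteq> {0, 1, -1}" using assms(2) by fastforce
  note * = alternating_line_prefix_sums[OF assms(1) this]
  show "m \<le> n \<Longrightarrow> sum f {1..m} \<in> {0, 1}"
    using *(1)[of m] sum_list_take_map_upt[of m n f] by (simp del: upt_Suc)
  show "sum f {1..n} = 1"
    using *(2) sum_list_take_map_upt[of n n f] by (simp del: upt_Suc)
qed

lemma entries_if_prefix_sums:
  fixes f :: "nat \<Rightarrow> real"
  assumes "\<And>m. m \<le> n \<Longrightarrow> sum f {1..m} \<in> {0, 1}" "j \<in> {1..n}"
  shows "f j \<in> {0, 1, -1}"
proof -
  obtain i where i: "j = Suc i" using assms(2) by (cases j) auto
  have "sum f {1..j} = sum f {1..i} + f j" by (simp add: i)
  moreover have "sum f {1..j} \<in> {0, 1}" "sum f {1..i} \<in> {0, 1}"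
    using assms(1)[of j] assms(1)[of i] assms(2) by (simp_all add: i)
  ultimately show ?thesis by auto
qed

lemma sum_reflect:
  fixes f :: "nat \<Rightarrow> real"
  assumes "u \<le> m" "m \<le> n"
  shows "(\<Sum>s=Suc u..m. f (n + 1 - s)) = sum f {1..n - u} - sum f {1..n - m}"
proof -
  have "(\<Sum>s=Suc u..m. f (n + 1 - s)) = sum f {n + 1 - m..n - u}"
    by (rule sum.reindex_bij_witness[of _ "\<lambda>t. n + 1 - t" "\<lambda>t. n + 1 - t"]) (use assms in auto)
  also have "\<dots> = sum f {1..n - u} - sum f {1..n - m}"
  proof -
    have "{1..n - u} = {1..n - m} \<union> {n + 1 - m..n - u}" using assms by auto
    moreover have "{1..n - m} \<inter> {n + 1 - m..n - u} = {}" by auto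
    ultimately show ?thesis by (simp add: sum.union_disjoint)
  qed
  finally show ?thesis .
qed

lemma ASM_prefix_sums:
  assumes "X \<in> ASM n" "i \<in> {1..n}"
  shows "m \<le> n \<Longrightarrow> (\<Sum>j=1..m. entry X i j) \<in> {0, 1}" "(\<Sum>j=1..n. entry X i j) = 1"
    "m \<le> n \<Longrightarrow> (\<Sum>j=1..m. entry X j i) \<in> {0, 1}" "(\<Sum>j=1..n. entry X j i) = 1"
proof -
  have "alternating_line (map (\<lambda>j. entry X i j) [1..<Suc n])"
    "alternating_line (map (\<lambda>j. entry X j i) [1..<Suc n])"
    "\<And>j. j \<in> {1..n} \<Longrightarrow> entry X i j \<in> {0, 1, -1}"
    "\<And>j. j \<in> {1..n} \<Longrightarrow> entry X j i \<in> {0, 1, -1}"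
    using assms unfolding ASM_def by blast+
  note * = alternating_line_map_prefix_sums[OF this(1,3)]
    alternating_line_map_prefix_sums[OF this(2,4)]
  show "m \<le> n \<Longrightarrow> (\<Sum>j=1..m. entry X i j) \<in> {0, 1}" "(\<Sum>j=1..n. entry X i j) = 1"
    "m \<le> n \<Longrightarrow> (\<Sum>j=1..m. entry X j i) \<in> {0, 1}" "(\<Sum>j=1..n. entry X j i) = 1"
    using * by blast+
qed

text \<open>By the symmetry, column \<open>j\<close> is row \<open>j\<close> read backwards, so its
  prefix sums are one minus prefix sums of that row.\<close>

lemma QTSASM_if_row_prefix_sums:
  assumes X: "is_matrix n X"
    and turn: "\<And>i j. i \<in> {1..n} \<Longrightarrow> j \<in> {1..n} \<Longrightarrow> entry X i j = entry X j (n + 1 - i)"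
    and sums: "\<And>i m. i \<in> {1..n} \<Longrightarrow> m \<le> n \<Longrightarrow> (\<Sum>j=1..m. entry X i j) \<in> {0, 1}"
    and total: "\<And>i. i \<in> {1..n} \<Longrightarrow> (\<Sum>j=1..n. entry X i j) = 1"
  shows "X \<in> QTSASM n"
proof -
  have col: "(\<Sum>i=1..m. entry X i j) = 1 - (\<Sum>i=1..n - m. entry X j i)"
    if "j \<in> {1..n}" "m \<le> n" for j m
  proof -
    have "(\<Sum>i=1..m. entry X i j) = (\<Sum>i=Suc 0..m. entry X j (n + 1 - i))"
      by (rule sum.cong) (use that turn in auto)
    then show ?thesis
      using sum_reflect[of 0 m n "entry X j"] that total by simp
  qed
  have "alternating_line (map (\<lambda>i. entry X i j) [1..<Suc n])" if "j \<in> {1..n}" for j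
  proof (rule alternating_line_map_if_prefix_sums)
    fix m assume "m \<le> n"
    then show "(\<Sum>i=1..m. entry X i j) \<in> {0, 1}"
      using col[of j m] sums[of j "n - m"] that by auto
  qed (use col[of j n] that in simp)
  moreover have "alternating_line (map (\<lambda>j. entry X i j) [1..<Suc n])" if "i \<in> {1..n}" for i
    using that sums total by (intro alternating_line_map_if_prefix_sums)
  moreover have "entry X i j \<in> {0, 1, -1}" if "i \<in> {1..n}" "j \<in> {1..n}" for i j
    using that sums by (intro entries_if_prefix_sums[of n "entry X i"])
  ultimately show ?thesis using X turn unfolding QTSASM_def ASM_def by blast
qed

text \<open>
  The quarter of an \<open>n \<times> n\<close> quarter-turn symmetric matrix formed by its first \<open>k = n div 2\<close> rows
  and first \<open>n - k\<close> columns determines all entries but the central one. Row \<open>i \<le> k\<close> of the matrix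
  is row \<open>i\<close> of the quarter followed by the reversed column \<open>i\<close> of the quarter; for odd \<open>n\<close> the
  central entry is then forced by the sum of the central row.
\<close>
definition unfold_entry :: "nat \<Rightarrow> (nat \<Rightarrow> nat \<Rightarrow> real) \<Rightarrow> nat \<Rightarrow> nat \<Rightarrow> real" where
  "unfold_entry n a r s =
    (let k = n div 2; l = n - k in
     if r \<le> k \<and> s \<le> l then a r s
     else if r \<le> l \<and> s > l then a (n + 1 - s) r
     else if r > l \<and> s > k then a (n + 1 - r) (n + 1 - s)
     else if r > k \<and> s \<le> k then a s (n + 1 - r)
     else 1 - 2 * (\<Sum>i=1..k. a i l))"

definition unfold_quarter :: "nat \<Rightarrow> (nat \<Rightarrow> nat \<Rightarrow> real) \<Rightarrow> real_matrix" where
  "unfold_quarter n a = Abs_poly_mapping (\<lambda>(r, s).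
     if r \<in> {1..n} \<and> s \<in> {1..n} then unfold_entry n a r s else 0)"

lemma lookup_unfold_quarter:
  "Poly_Mapping.lookup (unfold_quarter n a) =
    (\<lambda>(r, s). if r \<in> {1..n} \<and> s \<in> {1..n} then unfold_entry n a r s else 0)"
  unfolding unfold_quarter_def
  by (rule lookup_Abs_poly_mapping, rule finite_subset[of _ "{1..n} \<times> {1..n}"])
    (auto split: if_splits)

text \<open>In a row \<open>i \<le> k\<close>, a prefix sum within the quarter is a prefix sum of
  its row \<open>i\<close>; a longer one is, by \<open>line\<close>, one minus a prefix sum of its
  column \<open>i\<close>. For odd \<open>n\<close> the central row carries column \<open>l\<close>
  of the quarter on both sides of the central entry. The remaining rows follow by the
  half-turn.\<close>

lemma unfold_quarter_QTSASM:
  assumes k: "k = n div 2" and l: "l = n - k"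
    and row: "\<And>i m. i \<in> {1..k} \<Longrightarrow> m \<le> l \<Longrightarrow> sum (a i) {1..m} \<in> {0, 1}"
    and col: "\<And>j m. j \<in> {1..l} \<Longrightarrow> m \<le> k \<Longrightarrow> (\<Sum>i=1..m. a i j) \<in> {0, 1}"
    and line: "\<And>i. i \<in> {1..k} \<Longrightarrow> sum (a i) {1..l} + (\<Sum>j=1..k. a j i) = 1"
  shows "unfold_quarter n a \<in> QTSASM n"
proof -
  let ?x = "unfold_entry n a"
  have kl: "k + l = n" "k \<le> l" "l \<le> k + 1" using k l by linarith+
  have nl: "n - l = k" using kl by linarith
  have x0: "?x i j = a i j" if "i \<le> k" "j \<le> l" for i j
    using that by (simp add: unfold_entry_def k l)
  have x1: "?x i j = a (n + 1 - j) i" if "i \<le> l" "j > l" for i j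
    using that by (simp add: unfold_entry_def k l)
  have x2: "?x i j = a (n + 1 - i) (n + 1 - j)" if "i > l" "j > k" for i j
    using that kl by (simp add: unfold_entry_def Let_def flip: k l)
  have x3: "?x i j = a j (n + 1 - i)" if "i > k" "j \<le> k" for i j
    using that kl by (simp add: unfold_entry_def Let_def flip: k l)
  have x4: "?x (k + 1) (k + 1) = 1 - 2 * (\<Sum>i=1..k. a i l)" if "l = k + 1"
    using that by (simp add: unfold_entry_def Let_def flip: k l)
  have entry: "entry (unfold_quarter n a) i j = ?x i j" if "i \<in> {1..n}" "j \<in> {1..n}" for i j
    using that by (simp add: lookup_unfold_quarter)
  have turn: "?x i j = ?x j (n + 1 - i)" if "i \<in> {1..n}" "j \<in> {1..n}" for i j
  proof -
    consider "i \<le> k" "j \<le> l" | "i \<le> l" "j > l" | "i > l" "j > k" | "i > k" "j \<le> k"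
      | "i = k + 1" "j = k + 1" "l = k + 1"
      using kl by linarith
    then show ?thesis
    proof cases
      case 1
      then show ?thesis using x0[of i j] x1[of j "n + 1 - i"] that kl by simp
    next
      case 2
      then show ?thesis using x1[of i j] x2[of j "n + 1 - i"] that kl by simp
    next
      case 3
      then show ?thesis using x2[of i j] x3[of j "n + 1 - i"] that kl by simp
    next
      case 4
      then show ?thesis using x3[of i j] x0[of j "n + 1 - i"] that kl by simp
    next
      case 5
      then have "n + 1 - i = i" using kl by simp
      then show ?thesis using 5 by simp
    qed
  qed
  have half: "?x i j = ?x (n + 1 - i) (n + 1 - j)" if "i \<in> {1..n}" "j \<in> {1..n}" for i j
  proof -
    have "n + 1 - i \<in> {1..n}" using that by auto
    then show ?thesis using turn[of i j] turn[of j "n + 1 - i"] that by simp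
  qed
  have sums_top: "sum (?x i) {1..m} \<in> {0, 1} \<and> sum (?x i) {1..n} = 1" if i: "i \<in> {1..k}" and m: "m \<le> n" for i m
  proof -
    have small: "sum (?x i) {1..m} = sum (a i) {1..m}" if "m \<le> l" for m
      by (rule sum.cong) (use that i x0 in auto)
    have big: "sum (?x i) {1..m} = 1 - (\<Sum>j=1..n - m. a j i)" if "l \<le> m" "m \<le> n" for m
    proof -
      have "{1..m} = {1..l} \<union> {Suc l..m}" using that by auto
      then have "sum (?x i) {1..m} = sum (?x i) {1..l} + sum (?x i) {Suc l..m}"
        by (simp add: sum.union_disjoint)
      also have "sum (?x i) {Suc l..m} = (\<Sum>s=Suc l..m. a (n + 1 - s) i)"
        by (rule sum.cong) (use i kl x1 in auto)
      also have "\<dots> = (\<Sum>j=1..k. a j i) - (\<Sum>j=1..n - m. a j i)"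
        using sum_reflect[of l m n "\<lambda>j. a j i"] that nl by simp
      finally show ?thesis using small[of l] line[OF i] by simp
    qed
    have "i \<in> {1..l}" using i kl by auto
    then show ?thesis
      using small[of m] big[of m] big[of n] row[OF i, of m] col[of i "n - m"] m kl
      by (cases "m \<le> l") auto
  qed
  have sums_mid: "sum (?x (k + 1)) {1..m} \<in> {0, 1} \<and> sum (?x (k + 1)) {1..n} = 1"
    if kl1: "l = k + 1" and m: "m \<le> n" for m
  proof -
    have small: "sum (?x (k + 1)) {1..m} = (\<Sum>j=1..m. a j l)" if "m \<le> k" for m
      by (rule sum.cong) (use that kl kl1 x3[of "k + 1"] in auto)
    have big: "sum (?x (k + 1)) {1..m} = 1 - (\<Sum>j=1..n - m. a j l)" if "k < m" "m \<le> n" for m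
    proof -
      have "{1..m} = {1..k} \<union> insert (k + 1) {Suc l..m}" using that kl1 by auto
      then have "sum (?x (k + 1)) {1..m} = sum (?x (k + 1)) {1..k} + (?x (k + 1) (k + 1) + sum (?x (k + 1)) {Suc l..m})"
        using kl1 by (simp add: sum.union_disjoint)
      also have "sum (?x (k + 1)) {Suc l..m} = (\<Sum>s=Suc l..m. a (n + 1 - s) l)"
        by (rule sum.cong) (use kl1 x1[of "k + 1"] in auto)
      also have "\<dots> = (\<Sum>j=1..k. a j l) - (\<Sum>j=1..n - m. a j l)"
        using sum_reflect[of l m n "\<lambda>j. a j l"] that kl1 nl by simp
      also have "?x (k + 1) (k + 1) = 1 - 2 * (\<Sum>i=1..k. a i l)"
        using x4 kl1 .
      finally show ?thesis using small[of k] by simp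
    qed
    show ?thesis
      using small[of m] big[of m] big[of n] col[of l m] col[of l "n - m"] m kl kl1
      by (cases "m \<le> k") auto
  qed
  have sums: "sum (?x i) {1..m} \<in> {0, 1} \<and> sum (?x i) {1..n} = 1" if i: "i \<in> {1..n}" and m: "m \<le> n" for i m
  proof (cases "i \<le> l")
    case True
    then consider "i \<in> {1..k}" | "i = k + 1" "l = k + 1" using i kl by fastforce
    then show ?thesis using sums_top sums_mid m by cases auto
  next
    case False
    then have i': "n + 1 - i \<in> {1..k}" using i kl by auto
    have "sum (?x i) {1..m} = 1 - sum (?x (n + 1 - i)) {1..n - m}" if "m \<le> n" for m
    proof -
      have "sum (?x i) {1..m} = (\<Sum>j=Suc 0..m. ?x (n + 1 - i) (n + 1 - j))"
        by (rule sum.cong) (use i that half in auto)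
      then show ?thesis
        using sum_reflect[of 0 m n "?x (n + 1 - i)"] that sums_top[OF i', of n] by simp
    qed
    from this[of m] this[of n] show ?thesis
      using sums_top[OF i', of "n - m"] m by auto
  qed
  show ?thesis
  proof (rule QTSASM_if_row_prefix_sums)
    show "is_matrix n (unfold_quarter n a)"
      by (auto simp: is_matrix_def in_keys_iff lookup_unfold_quarter split: if_splits)
    show "entry (unfold_quarter n a) i j = entry (unfold_quarter n a) j (n + 1 - i)"
      if "i \<in> {1..n}" "j \<in> {1..n}" for i j
      using that turn[OF that] by (subst (1 2) entry) auto
    have eq: "(\<Sum>j=1..m. entry (unfold_quarter n a) i j) = sum (?x i) {1..m}"
      if "i \<in> {1..n}" "m \<le> n" for i m
      by (rule sum.cong) (use entry that in auto)
    show "(\<Sum>j=1..m. entry (unfold_quarter n a) i j) \<in> {0, 1}" if "i \<in> {1..n}" "m \<le> n" for i m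
      using eq[OF that] sums[OF that] by simp
    show "(\<Sum>j=1..n. entry (unfold_quarter n a) i j) = 1" if "i \<in> {1..n}" for i
      using eq[OF that, of n] sums[OF that, of n] by simp
  qed
qed

lemma lookup_scaleR_poly_mapping:
  "Poly_Mapping.lookup (t *\<^sub>R (X :: 'a \<Rightarrow>\<^sub>0 real)) p = t * Poly_Mapping.lookup X p"
proof -
  have "finite {i. t * Poly_Mapping.lookup X i \<noteq> 0}"
    by (rule finite_subset[of _ "Poly_Mapping.keys X"]) (auto simp: in_keys_iff)
  then show ?thesis by (simp add: scaleR_poly_mapping_def lookup_Abs_poly_mapping)
qed

lemma linear_sum_lookup:
  "linear (\<lambda>X :: 'a \<Rightarrow>\<^sub>0 real. \<Sum>p\<in>A. Poly_Mapping.lookup X p)"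
  by (rule linearI) (simp_all add: lookup_add lookup_scaleR_poly_mapping sum.distrib sum_distrib_left)

text \<open>The constant 1 in the central entry makes unfolding affine rather than linear, hence the
  subtracted image of the zero quarter.\<close>

lemma unfold_quarter_affine:
  "unfold_quarter n (\<lambda>r s. a r s + t * b r s) =
   unfold_quarter n a + t *\<^sub>R (unfold_quarter n b - unfold_quarter n (\<lambda>r s. 0))"
  by (rule poly_mapping_eqI)
    (auto simp: lookup_add lookup_minus lookup_scaleR_poly_mapping lookup_unfold_quarter
      unfold_entry_def Let_def sum.distrib sum_distrib_left algebra_simps)

lemma finite_QTSASM: "finite (QTSASM n)"
proof (rule finite_subset)
  show "QTSASM n \<subseteq> Abs_poly_mapping ` {f. f ` ({1..n} \<times> {1..n}) \<subseteq> {0, 1, -1} \<and>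
    {p. f p \<noteq> 0} \<subseteq> {1..n} \<times> {1..n}}"
  proof
    fix X assume X: "X \<in> QTSASM n"
    then have *: "Poly_Mapping.keys X \<subseteq> {1..n} \<times> {1..n}"
      "Poly_Mapping.lookup X ` ({1..n} \<times> {1..n}) \<subseteq> {0, 1, -1}"
      by (auto simp: QTSASM_def ASM_def is_matrix_def)
    have "X = Abs_poly_mapping (Poly_Mapping.lookup X)" by (simp add: lookup_inverse)
    then show "X \<in> Abs_poly_mapping ` {f. f ` ({1..n} \<times> {1..n}) \<subseteq> {0, 1, -1} \<and>
      {p. f p \<noteq> 0} \<subseteq> {1..n} \<times> {1..n}}"
      using * by (intro image_eqI[of _ _ "Poly_Mapping.lookup X"]) (auto simp: in_keys_iff)
  qed
  have "finite {f. \<forall>p. (p \<in> {1..n} \<times> {1..n} \<longrightarrow> f p \<in> {0, 1, -1}) \<and>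
      (p \<notin> {1..n} \<times> {1..n} \<longrightarrow> f p = (0::real))}"
    by (rule finite_set_of_finite_funs) auto
  then show "finite (Abs_poly_mapping ` {f. f ` ({1..n} \<times> {1..n}) \<subseteq> {0, 1, -1 :: real} \<and>
    {p. f p \<noteq> 0} \<subseteq> {1..n} \<times> {1..n}})"
    by (intro finite_imageI) (erule rev_finite_subset, auto)
qed

section \<open>Sparse quarters\<close>

text \<open>
  A quarter given by its nonzero entries \<open>(value, row, column)\<close>; repeated cells add up.
\<close>
type_synonym sparse = "(real \<times> nat \<times> nat) list"

definition sparse_entry :: "sparse \<Rightarrow> nat \<Rightarrow> nat \<Rightarrow> real" where
  "sparse_entry cs r c = (\<Sum>(s, i, j)\<leftarrow>cs. if i = r \<and> j = c then s else 0)"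

definition row_prefix :: "sparse \<Rightarrow> nat \<Rightarrow> nat \<Rightarrow> real" where
  "row_prefix cs r m = (\<Sum>(s, i, j)\<leftarrow>cs. if i = r \<and> j \<le> m then s else 0)"

definition col_prefix :: "sparse \<Rightarrow> nat \<Rightarrow> nat \<Rightarrow> real" where
  "col_prefix cs c m = (\<Sum>(s, i, j)\<leftarrow>cs. if j = c \<and> i \<le> m then s else 0)"

text \<open>Independent of \<open>n\<close>, so that one list serves \<open>n = 2 * K\<close> and
  \<open>n = 2 * K + 1\<close>, and also \<open>n = 2 * K - 1\<close> if row \<open>K\<close> is
  empty.\<close>

definition alternating_quarter :: "nat \<Rightarrow> sparse \<Rightarrow> bool" where
  "alternating_quarter K cs \<longleftrightarrow>
    (\<forall>(s, i, j)\<in>set cs. i \<in> {1..K} \<and> j \<in> {1..K}) \<and>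
    (\<forall>i\<in>{1..K}. \<forall>m. row_prefix cs i m \<in> {0, 1} \<and> col_prefix cs i m \<in> {0, 1}) \<and>
    (\<forall>i\<in>{1..K}. row_prefix cs i K + col_prefix cs i K = 1)"

text \<open>With \<open>K + 2 = 2 * h\<close>, rows before \<open>h\<close> and columns from
  \<open>h\<close> to \<open>K\<close> carry one 1 each, so every index has its 1 in exactly one of
  its row and column. The cells in rows from 2 on have \<open>i + j = K + 2\<close>, just beyond the
  staircase.\<close>

definition antidiagonal :: "nat \<Rightarrow> sparse" where
  "antidiagonal h = (1, 1, h) # map (\<lambda>x. (1, x, 2 * h - x)) [2..<h]"

lemma row_prefix_append [simp]: "row_prefix (cs @ ds) r m = row_prefix cs r m + row_prefix ds r m"
  and col_prefix_append [simp]: "col_prefix (cs @ ds) r m = col_prefix cs r m + col_prefix ds r m"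
  by (simp_all add: row_prefix_def col_prefix_def)

lemma prefix_Cons [simp]:
  "row_prefix ((s, i, j) # ds) r m = (if i = r \<and> j \<le> m then s else 0) + row_prefix ds r m"
  "col_prefix ((s, i, j) # ds) c m = (if j = c \<and> i \<le> m then s else 0) + col_prefix ds c m"
  "row_prefix [] r m = 0" "col_prefix [] c m = 0"
  by (simp_all add: row_prefix_def col_prefix_def)

lemma row_prefix_antidiagonal [simp]:
  "row_prefix (antidiagonal h) r m =
    (if r = 1 \<and> h \<le> m then 1 else 0) + (if 2 \<le> r \<and> r < h \<and> 2 * h \<le> r + m then 1 else 0)"
proof -
  have "row_prefix (antidiagonal h) r m = (if r = 1 \<and> h \<le> m then 1 else 0) +
      (\<Sum>x\<in>{2..<h}. if x = r \<and> 2 * h - x \<le> m then 1 else 0)"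
    by (auto simp: antidiagonal_def row_prefix_def interv_sum_list_conv_sum_set_nat o_def)
  also have "(\<Sum>x\<in>{2..<h}. if x = r \<and> 2 * h - x \<le> m then 1 else 0) =
      (\<Sum>x\<in>{2..<h}. if x = r then if 2 * h \<le> r + m then 1 else 0 else 0 :: real)"
    by (rule sum.cong) auto
  finally show ?thesis by simp
qed

lemma col_prefix_antidiagonal [simp]:
  "col_prefix (antidiagonal h) c m =
    (if c = h \<and> 1 \<le> m then 1 else 0) + (if h < c \<and> c + 2 \<le> 2 * h \<and> 2 * h \<le> c + m then 1 else 0)"
proof -
  have "col_prefix (antidiagonal h) c m = (if c = h \<and> 1 \<le> m then 1 else 0) +
      (\<Sum>x\<in>{2..<h}. if 2 * h - x = c \<and> x \<le> m then 1 else 0)"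
    by (auto simp: antidiagonal_def col_prefix_def interv_sum_list_conv_sum_set_nat o_def)
  also have "(\<Sum>x\<in>{2..<h}. if 2 * h - x = c \<and> x \<le> m then 1 else 0) =
      (\<Sum>x\<in>{2..<h}. if x = 2 * h - c then if h < c \<and> 2 * h \<le> c + m then 1 else 0 else 0 :: real)"
    by (rule sum.cong) auto
  finally show ?thesis by auto
qed

lemma alternating_quarter_antidiagonal_append:
  assumes "K + 2 = 2 * h" "3 \<le> h"
    and "\<And>s i j. (s, i, j) \<in> set ms \<Longrightarrow> 1 \<le> i \<and> i \<le> K \<and> 1 \<le> j \<and> j \<le> K"
    and "\<And>i m. 1 \<le> i \<Longrightarrow> i \<le> K \<Longrightarrow> row_prefix (antidiagonal h @ ms) i m \<in> {0, 1}"
    and "\<And>i m. 1 \<le> i \<Longrightarrow> i \<le> K \<Longrightarrow> col_prefix (antidiagonal h @ ms) i m \<in> {0, 1}"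
    and "\<And>i. 1 \<le> i \<Longrightarrow> i \<le> K \<Longrightarrow>
      row_prefix (antidiagonal h @ ms) i K + col_prefix (antidiagonal h @ ms) i K = 1"
  shows "alternating_quarter K (antidiagonal h @ ms)"
proof -
  have "\<forall>(s, i, j)\<in>set (antidiagonal h @ ms). i \<in> {1..K} \<and> j \<in> {1..K}"
    using assms(1-3) by (fastforce simp: antidiagonal_def)
  then show ?thesis
    unfolding alternating_quarter_def using assms(4-6) by auto
qed

text \<open>
  The matrices used below, as modifications of \<open>antidiagonal h\<close> (where \<open>K + 2 = 2 * h\<close>).
  In the staircase \<open>i, j \<ge> 2\<close>, \<open>i + j \<le> K + 1\<close>, the \<open>swap\<close>, \<open>flip\<close> and \<open>diagonal\<close> matrices
  vanish (except for the suffix \<open>last\<close>, which is needed only for odd \<open>n div 2 = K - 1\<close>, when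
  the cells with \<open>i + j = K + 1\<close> do not belong to the staircase), the \<open>cell\<close> matrices have a single
  1 at \<open>(i, j)\<close>, the \<open>row_link\<close> matrices a 1 at \<open>(i, 2)\<close> and a \<open>-1\<close> at \<open>(i, j)\<close>, and the
  \<open>column_link\<close> matrices a 1 at \<open>(2, 2)\<close> and a \<open>-1\<close> at \<open>(i, 2)\<close>. No row \<open>K\<close> entry is used
  except in \<open>flip\<close> and \<open>diagonal\<close> with \<open>q = K\<close>, so for odd \<open>n = 2 * K - 1\<close> column \<open>K\<close> can serve
  as the central column.
\<close>

lemma quarter_antidiagonal:
  assumes "K + 2 = 2 * h" "3 \<le> h"
  shows "alternating_quarter K (antidiagonal h @
    [])"
  by (rule alternating_quarter_antidiagonal_append) (use assms in auto)

text \<open>A -1 on a cell of the antidiagonal deletes the 1 there. Here one 1 moves along row 1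
  from \<open>(1, h)\<close> to \<open>(1, x)\<close>, the other along column \<open>p\<close> from
  \<open>(x, p)\<close> to \<open>(h, p)\<close>.\<close>

lemma quarter_swap:
  assumes "K + 2 = 2 * h" "3 \<le> h" "x + p = 2 * h" "2 \<le> x" "x < h"
  shows "alternating_quarter K (antidiagonal h @
    [(-1, 1, h), (-1, x, p), (1, 1, x), (1, h, p)])"
  by (rule alternating_quarter_antidiagonal_append) (use assms in auto)

lemma quarter_swap_transposed:
  assumes "K + 2 = 2 * h" "3 \<le> h" "x + p = 2 * h" "2 \<le> x" "x < h"
  shows "alternating_quarter K (antidiagonal h @
    [(-1, 1, h), (-1, x, p), (1, x, 1), (1, h, p)])"
  by (rule alternating_quarter_antidiagonal_append) (use assms in auto)

lemma quarter_first_transposed: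
  assumes "K + 2 = 2 * h" "3 \<le> h"
  shows "alternating_quarter K (antidiagonal h @
    [(-1, 1, h), (1, h, 1)])"
  by (rule alternating_quarter_antidiagonal_append) (use assms in auto)

lemma quarter_row_link:
  assumes "K + 2 = 2 * h" "3 \<le> h" "2 \<le> i" "3 \<le> j" "i + j < 2 * h"
  shows "alternating_quarter K (antidiagonal h @
    [(-1, 1, h), (-1, 2, K), (1, h, K), (1, 1, j), (1, i, 2), (-1, i, j)])"
  by (rule alternating_quarter_antidiagonal_append) (use assms in auto)

text \<open>The row link from \<open>(2, 2)\<close> with its -1 pushed to \<open>(2, K)\<close>,
  just outside the staircase: one -1 there deletes a 1, the other remains.\<close>

lemma quarter_corner:
  assumes "K + 2 = 2 * h" "3 \<le> h"
  shows "alternating_quarter K (antidiagonal h @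
    [(-1, 1, h), (-1, 2, K), (1, h, K), (1, 1, K), (1, 2, 2), (-1, 2, K)])"
  by (rule alternating_quarter_antidiagonal_append) (use assms in auto)

lemma quarter_column_link:
  assumes "K + 2 = 2 * h" "3 \<le> h" "3 \<le> i" "i < K"
  shows "alternating_quarter K (antidiagonal h @
    [(-1, 1, h), (-1, 2, K), (1, h, K), (1, i, 1), (1, 2, 2), (-1, i, 2)])"
  by (rule alternating_quarter_antidiagonal_append) (use assms in auto)

text \<open>For \<open>i = j\<close> the cells \<open>(j, q)\<close> and \<open>(i, p)\<close>
  coincide. The second -1 then is a true entry, enclosed in column \<open>p\<close> by the 1s in
  rows 1 and \<open>h\<close>.\<close>

lemma quarter_cell_low:
  assumes "K + 2 = 2 * h" "3 \<le> h" "i + p = 2 * h" "j + q = 2 * h" "2 \<le> i" "i < h" "2 \<le> j" "j < h"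
  shows "alternating_quarter K (antidiagonal h @
    [(-1, 1, h), (-1, j, q), (1, h, q), (1, i, j), (-1, i, p), (1, 1, p)])"
  by (rule alternating_quarter_antidiagonal_append) (use assms in auto)

lemma quarter_cell_middle_column:
  assumes "K + 2 = 2 * h" "3 \<le> h" "i + p = 2 * h" "2 \<le> i" "i < h"
  shows "alternating_quarter K (antidiagonal h @
    [(-1, 1, h), (1, i, h), (-1, i, p), (1, 1, p)])"
  by (rule alternating_quarter_antidiagonal_append) (use assms in auto)

lemma quarter_cell_middle_row:
  assumes "K + 2 = 2 * h" "3 \<le> h" "j + q = 2 * h" "2 \<le> j" "j < h"
  shows "alternating_quarter K (antidiagonal h @
    [(-1, 1, h), (-1, j, q), (1, h, j), (1, 1, q)])"
  by (rule alternating_quarter_antidiagonal_append) (use assms in auto)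

lemma quarter_cell_high_column:
  assumes "K + 2 = 2 * h" "3 \<le> h" "i + p = 2 * h" "j + q = 2 * h" "2 \<le> i" "i + j < 2 * h" "h < j"
  shows "alternating_quarter K (antidiagonal h @
    [(-1, 1, h), (-1, i, p), (1, h, p), (1, i, j), (-1, q, j), (1, 1, q)])"
  by (rule alternating_quarter_antidiagonal_append) (use assms in auto)

lemma quarter_cell_high_row:
  assumes "K + 2 = 2 * h" "3 \<le> h" "i + p = 2 * h" "j + q = 2 * h" "2 \<le> j" "i + j < 2 * h" "h < i"
  shows "alternating_quarter K (antidiagonal h @
    [(-1, 1, h), (-1, j, q), (1, h, q), (1, i, j), (-1, p, i), (1, 1, p)])"
  by (rule alternating_quarter_antidiagonal_append) (use assms in auto)

lemma quarter_flip:
  assumes "K + 2 = 2 * h" "3 \<le> h" "q + x = 2 * h" "h < q" "q \<le> K"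
  shows "alternating_quarter K (antidiagonal h @
    [(-1, x, q), (1, q, x)])"
  by (rule alternating_quarter_antidiagonal_append) (use assms in auto)

lemma quarter_diagonal:
  assumes "K + 2 = 2 * h" "3 \<le> h" "q + x = 2 * h" "h < q" "q \<le> K"
  shows "alternating_quarter K (antidiagonal h @
    [(-1, 1, h), (-1, x, q), (1, q, x), (1, h, h), (-1, h, q), (1, 1, q)])"
  by (rule alternating_quarter_antidiagonal_append) (use assms in auto)

lemma quarter_diagonal_transposed:
  assumes "K + 2 = 2 * h" "3 \<le> h" "h < q" "q \<le> K"
  shows "alternating_quarter K (antidiagonal h @
    [(-1, 1, h), (1, h, h), (-1, h, q), (1, q, 1)])"
  by (rule alternating_quarter_antidiagonal_append) (use assms in auto)

lemma quarter_diagonal_last: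
  assumes "K + 2 = 2 * h" "3 \<le> h" "4 \<le> h" "L + 1 = K"
  shows "alternating_quarter K (antidiagonal h @
    [(-1, 1, h), (-1, 2, K), (-1, 3, L), (1, h, h), (-1, h, L), (1, 2, L), (1, L, 3), (1, 1, K)])"
  by (rule alternating_quarter_antidiagonal_append) (use assms in auto)

lemma quarter_swap_last:
  assumes "K + 2 = 2 * h" "3 \<le> h" "4 \<le> h" "L + 1 = K"
  shows "alternating_quarter K (antidiagonal h @
    [(-1, 1, h), (-1, 2, K), (-1, 3, L), (1, 2, L), (1, 1, 3), (1, h, K)])"
  by (rule alternating_quarter_antidiagonal_append) (use assms in auto)

section \<open>Young diagrams in a staircase\<close>

text \<open>
  Row lengths of the Young diagrams with at most \<open>m\<close> rows, contained in the staircase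
  \<open>(m - 1, m - 2, \<dots>, 0)\<close> and with first row of length at most \<open>x\<close>.
\<close>
fun staircase_partitions :: "nat \<Rightarrow> nat \<Rightarrow> nat list set" where
  "staircase_partitions 0 x = {[]}"
| "staircase_partitions (Suc m) x =
    (\<Union>y\<in>{..min x m}. (#) y ` staircase_partitions m y)"

lemma finite_staircase_partitions: "finite (staircase_partitions m x)"
  by (induction m x rule: staircase_partitions.induct) auto

lemma card_staircase_partitions_Suc:
  "card (staircase_partitions (Suc m) x) = (\<Sum>y\<le>min x m. card (staircase_partitions m y))"
proof -
  have "card (staircase_partitions (Suc m) x) =
      (\<Sum>y\<le>min x m. card ((#) y ` staircase_partitions m y))"
    unfolding staircase_partitions.simps
    by (rule card_UN_disjoint) (auto intro: finite_staircase_partitions)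
  then show ?thesis by (simp add: card_image)
qed

text \<open>Ballot numbers, with the boundary values at \<open>j = 0\<close> split off because of truncated subtraction.\<close>
definition ballot :: "nat \<Rightarrow> nat \<Rightarrow> int" where
  "ballot i j = (if j = 0 then 1 else int ((i + j) choose j) - int ((i + j) choose (j - 1)))"

lemma ballot_step: "ballot (Suc i) (Suc j) = ballot (Suc i) j + ballot i (Suc j)"
proof (cases j)
  case 0
  then show ?thesis by (simp add: ballot_def)
next
  case (Suc l)
  then show ?thesis
    by (simp add: ballot_def)
qed

text \<open>The term that Pascal's rule adds is a difference of two binomials which are equal by
  symmetry.\<close>

lemma ballot_diagonal: "ballot (Suc i) (Suc i) = ballot (Suc i) i"
proof (cases i)
  case 0
  then show ?thesis by (simp add: ballot_def)
next
  case (Suc l)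
  have "Suc (i + i) choose Suc i = Suc (i + i) choose i"
    by (subst binomial_symmetric) auto
  then show ?thesis
    by (simp add: ballot_def Suc)
qed

lemma ballot_sum: "(\<Sum>y\<le>x. ballot i y) = ballot (Suc i) x"
proof (induction x)
  case 0
  then show ?case by (simp add: ballot_def)
next
  case (Suc x)
  then show ?case by (simp add: ballot_step)
qed

lemma card_staircase_partitions:
  "x \<le> m \<Longrightarrow> int (card (staircase_partitions m x)) = ballot m x"
proof (induction m arbitrary: x)
  case 0
  then show ?case by (simp add: ballot_def)
next
  case (Suc m)
  have "int (card (staircase_partitions (Suc m) x)) = (\<Sum>y\<le>min x m. ballot m y)"
    using Suc.IH by (simp add: card_staircase_partitions_Suc del: staircase_partitions.simps)
  also have "\<dots> = ballot (Suc m) (min x m)" by (rule ballot_sum)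
  \<comment> \<open>For \<open>x = Suc m\<close> the first row is capped at \<open>m\<close>; by
    \<open>ballot_diagonal\<close> the cap does not change the ballot number.\<close>
  also have "\<dots> = ballot (Suc m) x"
    using Suc.prems ballot_diagonal[of m] by (cases "x = Suc m") (auto simp: min_def)
  finally show ?case .
qed

lemma ballot_eq_Cat: "real_of_int (ballot m m) = Cat m"
proof (cases m)
  case 0
  then show ?thesis by (simp add: ballot_def Cat_def)
next
  case (Suc l)
  \<comment> \<open>Both sides equal \<open>2 * m\<close> times the binomial of
    \<open>2 * m - 1\<close> over \<open>l\<close>.\<close>
  have "m * ((2 * m) choose m) = (2 * m - l) * ((2 * m) choose l)"
    unfolding binomial_absorb_comp using binomial_absorption[of l "2 * m"] by (simp only: Suc)
  moreover have "2 * m - l = m + 1" using Suc by simp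
  ultimately have "real (m * ((2 * m) choose m)) = real ((m + 1) * ((2 * m) choose l))"
    by simp
  then have "real m * real ((2 * m) choose m) = (real m + 1) * real ((2 * m) choose l)"
    by (simp only: of_nat_mult of_nat_add of_nat_1)
  then have "real ((2 * m) choose l) = real m / (real m + 1) * real ((2 * m) choose m)"
    by (simp add: field_simps)
  moreover have "m \<noteq> 0" "m - 1 = l" using Suc by simp_all
  then have "real_of_int (ballot m m) = real ((2 * m) choose m) - real ((2 * m) choose l)"
    by (simp add: ballot_def mult_2)
  ultimately have "real_of_int (ballot m m) =
      real ((2 * m) choose m) - real m / (real m + 1) * real ((2 * m) choose m)"
    by (simp only:)
  also have "\<dots> = Cat m"
    unfolding Cat_def by (simp add: divide_simps) (simp add: algebra_simps)
  finally show ?thesis .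
qed

lemma staircase_partitions_nth:
  assumes "xs \<in> staircase_partitions m x"
  shows "length xs = m" "i < m \<Longrightarrow> xs ! i + i < m" "i < m \<Longrightarrow> xs ! i \<le> x"
    "i \<le> j \<Longrightarrow> j < m \<Longrightarrow> xs ! j \<le> xs ! i"
proof -
  have "length xs = m \<and> (\<forall>i<m. xs ! i + i < m \<and> xs ! i \<le> x) \<and> (\<forall>j<m. \<forall>i\<le>j. xs ! j \<le> xs ! i)"
    using assms
  proof (induction m x arbitrary: xs rule: staircase_partitions.induct)
    case (2 m x)
    then obtain y ys where xs: "xs = y # ys" and y: "y \<le> x" "y \<le> m" and ys: "ys \<in> staircase_partitions m y"
      by auto
    have IH: "length ys = m \<and> (\<forall>i<m. ys ! i + i < m \<and> ys ! i \<le> y) \<and> (\<forall>j<m. \<forall>i\<le>j. ys ! j \<le> ys ! i)"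
      using 2(1)[of y ys] y ys by simp
    have "\<forall>i<Suc m. xs ! i + i < Suc m \<and> xs ! i \<le> x"
    proof (intro allI impI)
      fix i assume "i < Suc m"
      then show "xs ! i + i < Suc m \<and> xs ! i \<le> x"
        using IH y by (cases i) (auto simp: xs intro: order_trans)
    qed
    moreover have "xs ! j \<le> xs ! i" if "j < Suc m" "i \<le> j" for i j
      using IH that by (cases i; cases j) (auto simp: xs)
    ultimately show ?case using IH by (simp add: xs)
  qed simp
  then show "length xs = m" "i < m \<Longrightarrow> xs ! i + i < m" "i < m \<Longrightarrow> xs ! i \<le> x"
    "i \<le> j \<Longrightarrow> j < m \<Longrightarrow> xs ! j \<le> xs ! i" by auto
qed

definition shape :: "nat list \<Rightarrow> (nat \<times> nat) set" where
  "shape xs = {(i + 2, j + 2) |i j. i < length xs \<and> j < xs ! i}"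

text \<open>The length has to be fixed because trailing zero rows leave no cells.\<close>

lemma inj_on_shape: "inj_on shape {xs. length xs = m}"
proof (rule inj_onI, clarify)
  fix xs ys :: "nat list" assume l: "length ys = length xs" and eq: "shape xs = shape ys"
  show "xs = ys"
  proof (rule nth_equalityI)
    fix i assume i: "i < length xs"
    have row: "{j. (i + 2, j + 2) \<in> shape zs} = {..<zs ! i}" if "length zs = length xs" for zs
      using i that by (auto simp: shape_def)
    show "xs ! i = ys ! i"
      using row[of xs] row[of ys] eq l by simp
  qed (simp add: l)
qed

text \<open>Requiring the corner excludes exactly the empty diagram; this is the 1 subtracted from
  the Catalan number.\<close>

definition young_diagrams :: "nat \<Rightarrow> (nat \<times> nat) set set" where
  "young_diagrams k = {A. (2, 2) \<in> A \<and> (\<forall>(i, j)\<in>A. 2 \<le> i \<and> 2 \<le> j \<and> i + j \<le> k + 1) \<and>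
    (\<forall>i j i' j'. (i, j) \<in> A \<and> 2 \<le> i' \<and> i' \<le> i \<and> 2 \<le> j' \<and> j' \<le> j \<longrightarrow> (i', j') \<in> A)}"

lemma finite_young_diagrams: "finite (young_diagrams k)"
proof (rule finite_subset)
  show "young_diagrams k \<subseteq> Pow ({..k + 1} \<times> {..k + 1})"
    by (fastforce simp: young_diagrams_def)
qed simp

lemma shape_young_diagram:
  assumes xs: "xs \<in> staircase_partitions (k - 1) x" and ne: "shape xs \<noteq> {}"
  shows "shape xs \<in> young_diagrams k"
proof -
  note nth = staircase_partitions_nth[OF xs]
  have ideal: "(i', j') \<in> shape xs"
    if ij: "(i, j) \<in> shape xs" and le: "2 \<le> i'" "i' \<le> i" "2 \<le> j'" "j' \<le> j" for i j i' j'
  proof -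
    obtain r c where rc: "i = r + 2" "j = c + 2" "r < length xs" "c < xs ! r"
      using ij by (auto simp: shape_def)
    have "xs ! r \<le> xs ! (i' - 2)" using rc le nth(1) by (intro nth(4)) auto
    then show ?thesis
      unfolding shape_def using le rc by (intro CollectI exI[of _ "i' - 2"] exI[of _ "j' - 2"]) auto
  qed
  have bound: "2 \<le> i \<and> 2 \<le> j \<and> i + j \<le> k + 1" if ij: "(i, j) \<in> shape xs" for i j
  proof -
    obtain r c where rc: "i = r + 2" "j = c + 2" "r < length xs" "c < xs ! r"
      using ij by (auto simp: shape_def)
    then show ?thesis using nth(1) nth(2)[of r] by auto
  qed
  obtain i j where "(i, j) \<in> shape xs" using ne by auto
  then have "(2, 2) \<in> shape xs" using bound[of i j] ideal[of i j 2 2] by auto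
  then show ?thesis unfolding young_diagrams_def using ideal bound by blast
qed

lemma card_young_diagrams: "Cat (k - 1) - 1 \<le> real (card (young_diagrams k))"
proof -
  let ?S = "staircase_partitions (k - 1) (k - 1)"
  have "inj_on shape ?S"
    by (rule inj_on_subset[OF inj_on_shape[of "k - 1"]]) (auto dest: staircase_partitions_nth(1))
  moreover have "shape ` ?S \<subseteq> insert {} (young_diagrams k)"
    using shape_young_diagram by auto
  ultimately have "card ?S \<le> card (insert {} (young_diagrams k))"
    using finite_young_diagrams by (intro card_inj_on_le) auto
  also have "\<dots> \<le> Suc (card (young_diagrams k))"
    by (rule card_insert_le_m1) auto
  finally have "real (card ?S) \<le> real (card (young_diagrams k)) + 1" by simp
  moreover have "real (card ?S) = Cat (k - 1)"
    using card_staircase_partitions[of "k - 1" "k - 1"] ballot_eq_Cat[of "k - 1"] by simp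
  ultimately show ?thesis by simp
qed

section \<open>Facets from Young diagrams\<close>

lemma young_diagram_notin:
  "A \<in> young_diagrams k \<Longrightarrow> i < 2 \<or> j < 2 \<or> k + 1 < i + j \<Longrightarrow> (i, j) \<notin> A"
  by (force simp: young_diagrams_def)

text \<open>Call the weighted sum of \<open>ms\<close> its excess. If both cells of a link are in
  \<open>A\<close>, its 1 and -1 cancel in the diagram sum, so its excess is 0 by
  \<open>tight\<close>. If the cell with the -1 is outside \<open>A\<close>, the cell matrix there
  is tight. Modulo relations among matrices vanishing in the staircase, column link plus cell matrix
  has the excess of the corner matrix; so has row link plus column link plus cell matrix, the column
  link being dropped in row 2. By \<open>pos\<close> the link in question then has positive
  excess.\<close>

lemma weights_determine_diagram:
  fixes W :: "nat \<Rightarrow> nat \<Rightarrow> real"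
  assumes K: "K + 2 = 2 * h" "3 \<le> h" and k: "k = K \<or> k + 1 = K" and A: "A \<in> young_diagrams k"
    and tight: "\<And>ms. alternating_quarter K (antidiagonal h @ ms) \<Longrightarrow>
      \<forall>(s, i, j)\<in>set ms. i \<le> k \<Longrightarrow> (\<Sum>(s, i, j)\<leftarrow>ms. if (i, j) \<in> A then s else 0) = 0 \<Longrightarrow>
      (\<Sum>(s, i, j)\<leftarrow>ms. s * W i j) = 0"
    and pos: "0 < - W 1 h - W 2 K + W h K + W 1 K + W 2 2 - W 2 K"
  shows "3 \<le> i \<Longrightarrow> i + 2 \<le> k + 1 \<Longrightarrow>
      (i, 2) \<in> A \<longleftrightarrow> - W 1 h - W 2 K + W h K + W i 1 + W 2 2 - W i 2 = 0"
    and "2 \<le> i \<Longrightarrow> 3 \<le> j \<Longrightarrow> i + j \<le> k + 1 \<Longrightarrow> (i, 2) \<in> A \<Longrightarrow>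
      (i, j) \<in> A \<longleftrightarrow> - W 1 h - W 2 K + W h K + W 1 j + W i 2 - W i j = 0"
proof -
  have notin [simp]: "(i, j) \<notin> A" if "i < 2 \<or> j < 2 \<or> k + 1 < i + j" for i j
    using young_diagram_notin[OF A that] .
  have corner [simp]: "(2, 2) \<in> A" using A by (simp add: young_diagrams_def)
  have bound: "2 \<le> i \<and> 2 \<le> j \<and> i + j \<le> k + 1" if "(i, j) \<in> A" for i j
    using that A by (auto simp: young_diagrams_def)
  have kK: "k \<le> K" "K \<le> k + 1" using k by auto
  \<comment> \<open>The relations up to \<open>eA2'\<close> come from matrices vanishing on
    \<open>A\<close>, whatever \<open>A\<close> is.\<close>
  have eA: "- W 1 h - W x p + W 1 x + W h p = 0" if "x + p = 2 * h" "2 \<le> x" "x < h" for x p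
    using tight[OF quarter_swap[OF K that]] that K kK by simp
  have eA': "- W 1 h - W x p + W x 1 + W h p = 0" if "x + p = 2 * h" "2 \<le> x" "x < h" for x p
    using tight[OF quarter_swap_transposed[OF K that]] that K kK by simp
  have eAm: "W h 1 = W 1 h"
    using tight[OF quarter_first_transposed[OF K]] K kK by simp
  have eflip: "W q x = W x q" if "q + x = 2 * h" "h < q" "q \<le> k" for q x
    using tight[OF quarter_flip[OF K that(1,2)]] that K kK by simp
  have eD1: "W 1 q - W h q = W 1 h - W h h" if "q + x = 2 * h" "h < q" "q \<le> k" for q x
    using tight[OF quarter_diagonal[OF K that(1,2)]] eflip[OF that] that K kK by simp
  have eDt: "W q 1 - W h q = W 1 h - W h h" if "h < q" "q \<le> k" for q
    using tight[OF quarter_diagonal_transposed[OF K that(1)]] that K kK by simp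
  \<comment> \<open>For \<open>k + 1 = K\<close>, \<open>quarter_diagonal\<close> at
    \<open>q = K\<close> would use the forbidden row \<open>K\<close>. The difference of the two
    \<open>last\<close> matrices gives the same relation.\<close>
  have eDK: "W 1 K - W h K = W 1 h - W h h" if "k = K \<or> 4 \<le> h"
  proof (cases "k = K")
    case True
    then show ?thesis using eD1[of K 2] K by simp
  next
    case False
    then have h: "4 \<le> h" and kL: "k + 1 = K" using that k by auto
    have "- W 1 h - W 2 K - W 3 k + W h h - W h k + W 2 k + W k 3 + W 1 K = 0"
      using tight[OF quarter_diagonal_last[OF K h kL]] K kL h by simp
    moreover have "- W 1 h - W 2 K - W 3 k + W 2 k + W 1 3 + W h K = 0"
      using tight[OF quarter_swap_last[OF K h kL]] K kL h by simp
    moreover have "W k 3 = W 3 k" using eflip[of k 3] K kL h by simp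
    moreover have "- W 1 h - W 3 k + W 1 3 + W h k = 0" using eA[of 3 k] K kL h by simp
    ultimately show ?thesis by linarith
  qed
  have eD: "W 1 q - W h q = W 1 h - W h h" if "q + x = 2 * h" "h < q" "q \<le> K" "k = K \<or> 4 \<le> h" for q x
  proof (cases "q \<le> k")
    case False
    then have "q = K" using that(3) k by linarith
    then show ?thesis using eDK[OF that(4)] by simp
  qed (use eD1[OF that(1,2)] in simp)
  have eA2: "- W 1 h - W 2 K + W 1 2 + W h K = 0" using eA[of 2 K] K by simp
  have eA2': "- W 1 h - W 2 K + W 2 1 + W h K = 0" using eA'[of 2 K] K by simp
  \<comment> \<open>The cell matrices are tight only when their cell lies outside
    \<open>A\<close>.\<close>
  have Y1: "- W 1 h - W j q + W h q + W i j - W i p + W 1 p = 0"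
    if "i + p = 2 * h" "j + q = 2 * h" "2 \<le> i" "i < h" "2 \<le> j" "j < h" "(i, j) \<notin> A" for i j p q
    using tight[OF quarter_cell_low[OF K that(1-6)]] that K kK by simp
  have Y2: "- W 1 h + W i h - W i p + W 1 p = 0"
    if "i + p = 2 * h" "2 \<le> i" "i < h" "(i, h) \<notin> A" for i p
    using tight[OF quarter_cell_middle_column[OF K that(1-3)]] that K kK by simp
  have Y3: "- W 1 h - W j q + W h j + W 1 q = 0"
    if "j + q = 2 * h" "2 \<le> j" "j < h" "(h, j) \<notin> A" for j q
    using tight[OF quarter_cell_middle_row[OF K that(1-3)]] that K kK by simp
  have Y4: "- W 1 h - W i p + W h p + W i j - W q j + W 1 q = 0"
    if "i + p = 2 * h" "j + q = 2 * h" "2 \<le> i" "i + j < 2 * h" "h < j" "(i, j) \<notin> A" for i j p q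
    using tight[OF quarter_cell_high_column[OF K that(1-5)]] that K kK by simp
  have Y5: "- W 1 h - W j q + W h q + W i j - W p i + W 1 p = 0"
    if "i + p = 2 * h" "j + q = 2 * h" "2 \<le> j" "i + j < 2 * h" "h < i" "i \<le> k" "(i, j) \<notin> A" for i j p q
    using tight[OF quarter_cell_high_row[OF K that(1-5)]] that K kK by simp
  show *: "(i, 2) \<in> A \<longleftrightarrow> - W 1 h - W 2 K + W h K + W i 1 + W 2 2 - W i 2 = 0"
    if i: "3 \<le> i" "i + 2 \<le> k + 1" for i
  proof
    assume "(i, 2) \<in> A"
    moreover have "i < K" using i kK by linarith
    ultimately show "- W 1 h - W 2 K + W h K + W i 1 + W 2 2 - W i 2 = 0"
      using tight[OF quarter_column_link[OF K i(1)]] i K kK by simp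
  next
    assume zero: "- W 1 h - W 2 K + W h K + W i 1 + W 2 2 - W i 2 = 0"
    show "(i, 2) \<in> A"
    proof (rule ccontr)
      assume out: "(i, 2) \<notin> A"
      \<comment> \<open>For \<open>h = 3\<close> and \<open>k = 3\<close> the staircase is the
        single cell \<open>(2, 2)\<close>, so a second cell excludes this case.\<close>
      have h4: "k = K \<or> 4 \<le> h" using i K k by auto
      have EK: "W 1 K - W h K = W 1 h - W h h" using eDK[OF h4] .
      obtain p where p: "i + p = 2 * h" using i K kK le_Suc_ex[of i "2 * h"] by auto
      \<comment> \<open>The antidiagonal has its 1s in rows before \<open>h\<close> and in columns
        from \<open>h\<close> on, so the suitable cell matrix depends on the position of
        \<open>i\<close> relative to \<open>h\<close>.\<close>
      consider "i < h" | "i = h" | "h < i" by linarith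
      then show False
      proof cases
        case 1
        have "W 1 p - W h p = W 1 h - W h h" using eD[of p i] p 1 i K h4 by simp
        then show False
          using Y1[of i p 2 K] eA[of i p] eA'[of i p] eA2 eA2' EK zero pos out i p 1 K by simp
      next
        case 2
        then show False
          using Y3[of 2 K] eAm eA2 eA2' EK zero pos out i K by simp
      next
        case 3
        have "W i 1 - W h i = W 1 h - W h h" using eDt[of i] 3 i by simp
        moreover have "- W 1 h - W p i + W 1 p + W h i = 0" using eA[of p i] 3 i p K kK by simp
        ultimately show False
          using Y5[of i p 2 K] eA2 eA2' EK zero pos out i p 3 K kK by simp
      qed
    qed
  qed
  show "(i, j) \<in> A \<longleftrightarrow> - W 1 h - W 2 K + W h K + W 1 j + W i 2 - W i j = 0"
    if ij: "2 \<le> i" "3 \<le> j" "i + j \<le> k + 1" and i2: "(i, 2) \<in> A" for i j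
  proof
    assume "(i, j) \<in> A"
    moreover have "i + j < 2 * h" using ij kK K by linarith
    ultimately show "- W 1 h - W 2 K + W h K + W 1 j + W i 2 - W i j = 0"
      using tight[OF quarter_row_link[OF K ij(1,2)]] i2 ij K kK by simp
  next
    assume zero: "- W 1 h - W 2 K + W h K + W 1 j + W i 2 - W i j = 0"
    show "(i, j) \<in> A"
    proof (rule ccontr)
      assume out: "(i, j) \<notin> A"
      have h4: "k = K \<or> 4 \<le> h" using ij K k by auto
      have EK: "W 1 K - W h K = W 1 h - W h h" using eDK[OF h4] .
      \<comment> \<open>The column link is tight since \<open>(i, 2)\<close> is in \<open>A\<close>;
        adding it moves the 1 of the row link from \<open>(i, 2)\<close> to the corner.\<close>
      have col: "i \<noteq> 2 \<Longrightarrow> - W 1 h - W 2 K + W h K + W i 1 + W 2 2 - W i 2 = 0"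
        using *[of i] i2 ij by simp
      obtain p where p: "i + p = 2 * h" using ij K kK le_Suc_ex[of i "2 * h"] by auto
      obtain q where q: "j + q = 2 * h" using ij K kK le_Suc_ex[of j "2 * h"] by auto
      have lt: "i + j < 2 * h" using ij K kK by linarith
      have row1: "i < h \<Longrightarrow> - W 1 h - W i p + W 1 i + W h p = 0"
        "i < h \<Longrightarrow> - W 1 h - W i p + W i 1 + W h p = 0"
        "i < h \<Longrightarrow> W 1 p - W h p = W 1 h - W h h"
        using eA[of i p] eA'[of i p] eD[of p i] p ij K h4 by simp_all
      have row2: "j < h \<Longrightarrow> - W 1 h - W j q + W 1 j + W h q = 0"
        "j < h \<Longrightarrow> - W 1 h - W j q + W j 1 + W h q = 0"
        "j < h \<Longrightarrow> W 1 q - W h q = W 1 h - W h h"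
        using eA[of j q] eA'[of j q] eD[of q j] q ij K h4 by simp_all
      have pK: "i = 2 \<Longrightarrow> p = K" using p K by simp
      consider (1) "i < h" "j < h" | (2) "i < h" "j = h" | (3) "i = h" "j < h"
        | (4) "i < h" "h < j" | (5) "h < i" "j < h" using lt by linarith
      then show False
      proof cases
        case 1
        then show False
          using Y1[of i p j q] row1 row2 eA2 eA2' EK zero pos col out pK ij p q by (cases "i = 2") auto
      next
        case 2
        then show False
          using Y2[of i p] row1 eA2 eA2' EK zero pos col out pK ij p by (cases "i = 2") auto
      next
        case 3
        then show False
          using Y3[of j q] row2 eAm eA2 eA2' EK zero pos col out ij K q by auto
      next
        case 4
        have "W 1 j - W h j = W 1 h - W h h" using eD[of j q] 4 q ij K kK h4 by simp
        moreover have "- W 1 h - W q j + W 1 q + W h j = 0" using eA[of q j] 4 q ij K kK by simp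
        ultimately show False
          using 4 Y4[of i p j q] row1 eA2 eA2' EK zero pos col out pK ij p q lt by (cases "i = 2") auto
      next
        case 5
        have "W i 1 - W h i = W 1 h - W h h" using eDt[of i] 5 ij by simp
        moreover have "- W 1 h - W p i + W 1 p + W h i = 0" using eA[of p i] 5 ij p K kK by simp
        ultimately show False
          using 5 Y5[of i p j q] row2 eA2 eA2' EK zero pos col out ij p q lt by auto
      qed
    qed
  qed
qed

section \<open>Sparse quarters as matrices, and linear functionals on them\<close>

lemma sparse_entry_Cons:
  "sparse_entry ((s, i, j) # cs) r c = sparse_entry cs r c + s * sparse_entry [(1, i, j)] r c"
  by (simp add: sparse_entry_def)

lemma sum_sparse_entry_row:
  "\<forall>(s, i, j)\<in>set cs. 1 \<le> j \<Longrightarrow> sum (sparse_entry cs r) {1..m} = row_prefix cs r m"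
proof (induction cs)
  case Nil
  then show ?case by (simp add: sparse_entry_def)
next
  case (Cons e cs)
  obtain s i j where e: "e = (s, i, j)" by (cases e)
  have "sum (sparse_entry (e # cs) r) {1..m} =
      sum (sparse_entry cs r) {1..m} + (\<Sum>c=1..m. if c = j then if i = r then s else 0 else 0)"
    unfolding sum.distrib[symmetric] by (rule sum.cong) (auto simp: e sparse_entry_def)
  then show ?case using Cons by (auto simp: e)
qed

lemma sum_sparse_entry_col:
  "\<forall>(s, i, j)\<in>set cs. 1 \<le> i \<Longrightarrow> (\<Sum>r=1..m. sparse_entry cs r c) = col_prefix cs c m"
proof (induction cs)
  case Nil
  then show ?case by (simp add: sparse_entry_def)
next
  case (Cons e cs)
  obtain s i j where e: "e = (s, i, j)" by (cases e)
  have "(\<Sum>r=1..m. sparse_entry (e # cs) r c) =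
      (\<Sum>r=1..m. sparse_entry cs r c) + (\<Sum>r=1..m. if r = i then if j = c then s else 0 else 0)"
    unfolding sum.distrib[symmetric] by (rule sum.cong) (auto simp: e sparse_entry_def)
  then show ?case using Cons by (auto simp: e)
qed

lemma prefix_eqI:
  "\<forall>(s, i, j)\<in>set cs. j \<le> K \<Longrightarrow> K \<le> m \<Longrightarrow> row_prefix cs r m = row_prefix cs r K"
  "\<forall>(s, i, j)\<in>set cs. i \<le> k \<Longrightarrow> k \<le> m \<Longrightarrow> col_prefix cs c m = col_prefix cs c k"
  "\<forall>(s, i, j)\<in>set cs. j \<le> K \<Longrightarrow> K < c \<Longrightarrow> col_prefix cs c m = 0"
  by (induction cs) auto

text \<open>The bounds leave \<open>K = k\<close>, or \<open>K = k + 1\<close> with odd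
  \<open>n\<close>. In the latter case row \<open>K\<close> is empty by \<open>rows\<close>, and
  column \<open>K\<close> becomes the central column.\<close>

lemma alternating_quarter_QTSASM:
  assumes cs: "alternating_quarter K cs" and rows: "\<forall>(s, i, j)\<in>set cs. i \<le> k"
    and k: "k = n div 2" "k \<le> K" "K \<le> n - k"
  shows "unfold_quarter n (sparse_entry cs) \<in> QTSASM n"
proof -
  have cells: "\<forall>(s, i, j)\<in>set cs. 1 \<le> i" "\<forall>(s, i, j)\<in>set cs. 1 \<le> j" "\<forall>(s, i, j)\<in>set cs. j \<le> K"
    using cs by (auto simp: alternating_quarter_def)
  have prefix: "row_prefix cs i m \<in> {0, 1}" "col_prefix cs i m \<in> {0, 1}"
      "row_prefix cs i K + col_prefix cs i K = 1" if "i \<in> {1..K}" for i m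
    using cs that by (auto simp only: alternating_quarter_def)
  note sums = sum_sparse_entry_row[OF cells(2)] sum_sparse_entry_col[OF cells(1)]
  show ?thesis
  proof (rule unfold_quarter_QTSASM[OF k(1) refl])
    fix i m assume "i \<in> {1..k}"
    then show "sum (sparse_entry cs i) {1..m} \<in> {0, 1}"
      unfolding sums using k by (intro prefix) auto
  next
    fix j m
    assume "j \<in> {1..n - k}"
    then show "(\<Sum>i=1..m. sparse_entry cs i j) \<in> {0, 1}"
      unfolding sums using prefix(2)[of j m] prefix_eqI(3)[OF cells(3), of j m] by (cases "j \<le> K") auto
  next
    fix i assume "i \<in> {1..k}"
    then have "row_prefix cs i K + col_prefix cs i K = 1" using k by (intro prefix) auto
    then show "sum (sparse_entry cs i) {1..n - k} + (\<Sum>j=1..k. sparse_entry cs j i) = 1"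
      unfolding sums
      using prefix_eqI(1)[OF cells(3) k(3), of i] prefix_eqI(2)[OF rows k(2), of i] by simp
  qed
qed

text \<open>The change of \<open>g\<close> caused by one more 1 at a cell; as unfolding is affine,
  it does not depend on the other entries.\<close>

definition cell_weight :: "nat \<Rightarrow> (real_matrix \<Rightarrow> real) \<Rightarrow> nat \<Rightarrow> nat \<Rightarrow> real" where
  "cell_weight n g i j =
    g (unfold_quarter n (sparse_entry [(1, i, j)])) - g (unfold_quarter n (\<lambda>r s. 0))"

lemma linear_unfold_sparse_append:
  assumes g: "linear g"
  shows "g (unfold_quarter n (sparse_entry (cs @ ms))) =
    g (unfold_quarter n (sparse_entry cs)) + (\<Sum>(s, i, j)\<leftarrow>ms. s * cell_weight n g i j)"
proof -
  have Cons_eq: "g (unfold_quarter n (sparse_entry ((s, i, j) # cs))) =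
      g (unfold_quarter n (sparse_entry cs)) + s * cell_weight n g i j" for s i j cs
  proof -
    have "sparse_entry ((s, i, j) # cs) =
        (\<lambda>r c. sparse_entry cs r c + s * sparse_entry [(1, i, j)] r c)"
      by (intro ext sparse_entry_Cons)
    then show ?thesis
      by (simp only: unfold_quarter_affine linear_add[OF g] linear_scale[OF g] linear_diff[OF g]
        cell_weight_def real_scaleR_def)
  qed
  have perm: "sparse_entry (cs @ ms) = sparse_entry (ms @ cs)"
    by (intro ext) (simp add: sparse_entry_def)
  have "g (unfold_quarter n (sparse_entry (ms @ cs))) =
    g (unfold_quarter n (sparse_entry cs)) + (\<Sum>(s, i, j)\<leftarrow>ms. s * cell_weight n g i j)"
  proof (induction ms)
    case (Cons e ms)
    then show ?case by (cases e) (simp add: Cons_eq)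
  qed simp
  then show ?thesis by (simp only: perm)
qed

lemma diagram_sum_unfold_sparse:
  assumes A: "A \<subseteq> {1..n div 2} \<times> {1..n - n div 2}"
  shows "(\<Sum>p\<in>A. Poly_Mapping.lookup (unfold_quarter n (sparse_entry cs)) p) =
    (\<Sum>(s, i, j)\<leftarrow>cs. if (i, j) \<in> A then s else 0)"
proof -
  have fin: "finite A" using A finite_subset by blast
  have "Poly_Mapping.lookup (unfold_quarter n (sparse_entry cs)) p = sparse_entry cs (fst p) (snd p)"
    if "p \<in> A" for p
    using that A by (cases p) (auto simp: lookup_unfold_quarter unfold_entry_def)
  then have "(\<Sum>p\<in>A. Poly_Mapping.lookup (unfold_quarter n (sparse_entry cs)) p) =
      (\<Sum>p\<in>A. sparse_entry cs (fst p) (snd p))" by (rule sum.cong[OF refl])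
  also have "\<dots> = (\<Sum>(s, i, j)\<leftarrow>cs. if (i, j) \<in> A then s else 0)"
  proof (induction cs)
    case Nil
    then show ?case by (simp add: sparse_entry_def)
  next
    case (Cons e cs)
    obtain s i j where e: "e = (s, i, j)" by (cases e)
    have "(\<Sum>p\<in>A. sparse_entry (e # cs) (fst p) (snd p)) =
        (\<Sum>p\<in>A. (if p = (i, j) then s else 0)) + (\<Sum>p\<in>A. sparse_entry cs (fst p) (snd p))"
      unfolding sum.distrib[symmetric]
      by (rule sum.cong) (auto simp: e sparse_entry_def)
    then show ?case using Cons fin by (simp add: e)
  qed
  finally show ?thesis .
qed

section \<open>Nonnegativity of diagram sums\<close>

lemma sum_ideal_ge:
  fixes f :: "nat \<Rightarrow> nat \<Rightarrow> real"
  assumes "finite A" and ge2: "\<And>i j. (i, j) \<in> A \<Longrightarrow> 2 \<le> j"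
    and ideal: "\<And>i j j'. (i, j) \<in> A \<Longrightarrow> 2 \<le> j' \<Longrightarrow> j' \<le> j \<Longrightarrow> (i, j') \<in> A"
    and prefix: "\<And>i j. (i, j) \<in> A \<Longrightarrow> 0 \<le> sum (f i) {1..j}"
  shows "- (\<Sum>i\<in>fst ` A. f i 1) \<le> (\<Sum>(i, j)\<in>A. f i j)"
proof -
  define R where "R i = {j. (i, j) \<in> A}" for i
  have finR: "finite (R i)" for i
    using \<open>finite A\<close> finite_subset[of "R i" "snd ` A"] by (force simp: R_def)
  have AR: "A = Sigma (fst ` A) R" by (force simp: R_def)
  have row: "- f i 1 \<le> sum (f i) (R i)" if "i \<in> fst ` A" for i
  proof -
    have ne: "R i \<noteq> {}" using that by (auto simp: R_def)
    define m where "m = Max (R i)"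
    have m: "(i, m) \<in> A" using Max_in[OF finR ne] by (simp add: m_def R_def)
    \<comment> \<open>A row of the diagram is a prefix of the matrix row without its first entry,
      and prefix sums are nonnegative.\<close>
    have "R i = {2..m}"
      using ideal[OF m] ge2 Max_ge[OF finR] by (auto simp: R_def m_def)
    moreover have "{1..m} = insert 1 {2..m}" using ge2[OF m] by auto
    ultimately show ?thesis using prefix[OF m] by simp
  qed
  have "(\<Sum>(i, j)\<in>A. f i j) = (\<Sum>i\<in>fst ` A. sum (f i) (R i))"
    using sum.Sigma[of "fst ` A" R "\<lambda>i j. f i j"] \<open>finite A\<close> finR AR by simp
  also have "\<dots> \<ge> (\<Sum>i\<in>fst ` A. - f i 1)" by (rule sum_mono) (rule row)
  finally show ?thesis by (simp add: sum_negf)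
qed

text \<open>
  Cutting the sum along rows bounds it below by minus a sum of entries in the first column,
  cutting it along columns by minus a sum of entries in the first row. Both sets of entries appear
  disjointly in the first row of the full matrix, whose sum is 1, and the sum is an integer.
\<close>
lemma diagram_sum_nonneg:
  assumes X: "X \<in> QTSASM n" and A: "A \<in> young_diagrams (n div 2)"
  shows "0 \<le> (\<Sum>p\<in>A. Poly_Mapping.lookup X p)"
proof -
  define k where "k = n div 2"
  define S where "S = (\<Sum>(i, j)\<in>A. entry X i j)"
  have bound: "2 \<le> i \<and> 2 \<le> j \<and> i + j \<le> k + 1" if "(i, j) \<in> A" for i j
    using that A by (auto simp: young_diagrams_def k_def)
  have ideal: "(i', j') \<in> A" if "(i, j) \<in> A" "2 \<le> i'" "i' \<le> i" "2 \<le> j'" "j' \<le> j" for i j i' j'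
    using that A unfolding young_diagrams_def by blast
  have in_n: "i \<in> {1..n} \<and> j \<in> {1..n}" if "(i, j) \<in> A" for i j
    using bound[OF that] by (auto simp: k_def)
  have fin: "finite A"
    by (rule finite_subset[of _ "{1..n} \<times> {1..n}"]) (use in_n in auto)
  have XA: "X \<in> ASM n" using X by (simp add: QTSASM_def)
  note prefix = ASM_prefix_sums[OF XA]
  have n1: "1 \<in> {1..n}" using in_n A by (fastforce simp: young_diagrams_def)
  have first: "entry X 1 j \<in> {0, 1}" if "j \<in> {1..n}" for j
    using prefix(3)[OF that, of 1] n1 by simp
  have turn: "entry X i 1 = entry X 1 (n + 1 - i)" if "i \<in> {1..n}" for i
    using X n1 that by (simp add: QTSASM_def)
  have rows: "- (\<Sum>i\<in>fst ` A. entry X i 1) \<le> S"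
    unfolding S_def
  proof (rule sum_ideal_ge[OF fin])
    fix i j assume ij: "(i, j) \<in> A"
    then show "0 \<le> sum (entry X i) {1..j}" using prefix(1)[of i j] in_n[OF ij] by auto
  next
    fix i j j' assume "(i, j) \<in> A" "2 \<le> j'" "j' \<le> j"
    then show "(i, j') \<in> A" using ideal[of i j i j'] bound[of i j] by auto
  qed (use bound in blast)
  have cols: "- (\<Sum>j\<in>snd ` A. entry X 1 j) \<le> S"
  proof -
    let ?B = "prod.swap ` A"
    have "- (\<Sum>j\<in>fst ` ?B. entry X 1 j) \<le> (\<Sum>(j, i)\<in>?B. entry X i j)"
    proof (rule sum_ideal_ge)
      fix j i assume "(j, i) \<in> ?B"
      then have ij: "(i, j) \<in> A" by auto
      then show "0 \<le> (\<Sum>t=1..i. entry X t j)" using prefix(3)[of j i] in_n[OF ij] by auto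
    next
      fix j i i' assume "(j, i) \<in> ?B" "2 \<le> i'" "i' \<le> i"
      then show "(j, i') \<in> ?B" using ideal[of i j i' j] bound[of i j] by force
    qed (use fin bound in auto)
    moreover have "fst ` ?B = snd ` A" by force
    moreover have "(\<Sum>(j, i)\<in>?B. entry X i j) = S"
      unfolding S_def by (subst sum.reindex) (auto simp: case_prod_beta o_def)
    ultimately show ?thesis by simp
  qed
  have "(\<Sum>i\<in>fst ` A. entry X i 1) = (\<Sum>s\<in>(\<lambda>i. n + 1 - i) ` fst ` A. entry X 1 s)"
  proof -
    have "inj_on (\<lambda>i. n + 1 - i) (fst ` A)"
      by (rule inj_onI) (use in_n in fastforce)
    then have "(\<Sum>s\<in>(\<lambda>i. n + 1 - i) ` fst ` A. entry X 1 s) = (\<Sum>i\<in>fst ` A. entry X 1 (n + 1 - i))"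
      by (simp add: sum.reindex)
    also have "\<dots> = (\<Sum>i\<in>fst ` A. entry X i 1)"
      by (rule sum.cong) (use turn in_n in force)+
    finally show ?thesis by simp
  qed
  moreover have "(\<Sum>s\<in>(\<lambda>i. n + 1 - i) ` fst ` A. entry X 1 s) + (\<Sum>j\<in>snd ` A. entry X 1 j) \<le> 1"
  proof -
    let ?U = "(\<lambda>i. n + 1 - i) ` fst ` A"
    have "?U \<inter> snd ` A = {}"
    proof -
      \<comment> \<open>Row and column indices of \<open>A\<close> are less than \<open>k\<close>,
        so the reflected rows lie to the right of all columns.\<close>
      have "n + 1 - i \<noteq> j'" if "(i, j) \<in> A" "(i', j') \<in> A" for i j i' j'
        using bound[OF that(1)] bound[OF that(2)] unfolding k_def by linarith
      then show ?thesis by force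
    qed
    then have "(\<Sum>s\<in>?U. entry X 1 s) + (\<Sum>j\<in>snd ` A. entry X 1 j) = (\<Sum>s\<in>?U \<union> snd ` A. entry X 1 s)"
      using fin by (simp add: sum.union_disjoint)
    also have "\<dots> \<le> (\<Sum>s=1..n. entry X 1 s)"
    proof (rule sum_mono2)
      show "?U \<union> snd ` A \<subseteq> {1..n}" using in_n by fastforce
      show "0 \<le> entry X 1 s" if "s \<in> {1..n} - (?U \<union> snd ` A)" for s
        using first[of s] that by auto
    qed simp
    finally show ?thesis using prefix(2)[OF n1] by simp
  qed
  ultimately have "- 1 \<le> 2 * S" using rows cols by linarith
  moreover have "S \<in> \<int>"
    unfolding S_def
  proof (rule Ints_sum)
    fix p assume "p \<in> A"
    then have "fst p \<in> {1..n}" "snd p \<in> {1..n}" using in_n[of "fst p" "snd p"] by auto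
    then have "entry X (fst p) (snd p) \<in> {0, 1, -1}" using XA unfolding ASM_def by blast
    then show "(case p of (i, j) \<Rightarrow> entry X i j) \<in> \<int>" by (auto simp: case_prod_beta)
  qed
  ultimately have "0 \<le> S" by (elim Ints_cases) auto
  then show ?thesis by (simp add: S_def case_prod_beta)
qed

section \<open>The injection from diagrams to facets\<close>

definition row_link :: "nat \<Rightarrow> nat \<Rightarrow> nat \<Rightarrow> nat \<Rightarrow> nat \<Rightarrow> real_matrix" where
  "row_link n h K i j = unfold_quarter n (sparse_entry (antidiagonal h @
    [(-1, 1, h), (-1, 2, K), (1, h, K), (1, 1, j), (1, i, 2), (-1, i, j)]))"

definition column_link :: "nat \<Rightarrow> nat \<Rightarrow> nat \<Rightarrow> nat \<Rightarrow> real_matrix" where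
  "column_link n h K i = unfold_quarter n (sparse_entry (antidiagonal h @
    [(-1, 1, h), (-1, 2, K), (1, h, K), (1, i, 1), (1, 2, 2), (-1, i, 2)]))"

text \<open>The right-hand side of the equivalence mentions \<open>F\<close> but not
  \<open>A\<close>, which makes the choice of facets injective. \<open>K\<close> is the even one of
  \<open>k\<close> and \<open>k + 1\<close>, as \<open>K + 2 = 2 * h\<close> demands.\<close>

lemma facet_of_young_diagram:
  assumes k: "k = n div 2" "3 \<le> k" and K: "K = (if even k then k else k + 1)" "K \<le> n - k"
    and h: "h = K div 2 + 1" and A: "A \<in> young_diagrams k"
  shows "\<exists>F. is_facet_of F (P_QTSASM n) \<and>
    (\<forall>i j. 2 \<le> i \<longrightarrow> 2 \<le> j \<longrightarrow> i + j \<le> k + 1 \<longrightarrow> ((i, j) \<in> A \<longleftrightarrow>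
      (i = 2 \<or> column_link n h K i \<in> F) \<and> (j = 2 \<or> row_link n h K i j \<in> F)))"
proof -
  have Kh: "K + 2 = 2 * h" using K h by (auto elim!: evenE oddE)
  have h3: "3 \<le> h"
  proof -
    have "4 \<le> K" using k(2) K(1) by (cases "k = 3") auto
    then show ?thesis using Kh by linarith
  qed
  have kK: "k = K \<or> k + 1 = K" "k \<le> K" using K by auto
  define M where "M ms = unfold_quarter n (sparse_entry (antidiagonal h @ ms))" for ms
  define f where "f X = (\<Sum>p\<in>A. Poly_Mapping.lookup X p)" for X :: real_matrix
  have bound: "2 \<le> i \<and> 2 \<le> j \<and> i + j \<le> k + 1" if "(i, j) \<in> A" for i j
    using that A by (auto simp: young_diagrams_def)
  have sub: "A \<subseteq> {1..n div 2} \<times> {1..n - n div 2}"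
    using bound kK K(2) k(1) by fastforce
  have "(\<Sum>(s, i, j)\<leftarrow>cs. if (i, j) \<in> A then s else 0) = (0::real)"
    if "\<forall>(s, i, j)\<in>set cs. (i, j) \<notin> A" for cs :: sparse
    using that by (induction cs) auto
  moreover have "\<forall>(s, i, j)\<in>set (antidiagonal h). (i, j) \<notin> A"
    using bound kK(2) Kh by (fastforce simp: antidiagonal_def)
  ultimately have "(\<Sum>(s, i, j)\<leftarrow>antidiagonal h. if (i, j) \<in> A then s else 0) = (0::real)"
    by blast
  then have fM: "f (M ms) = (\<Sum>(s, i, j)\<leftarrow>ms. if (i, j) \<in> A then s else 0)" for ms
    using diagram_sum_unfold_sparse[OF sub] by (simp add: f_def M_def)
  have base_rows: "\<forall>(s, i, j)\<in>set (antidiagonal h). i \<le> k"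
    using h3 Kh kK by (auto simp: antidiagonal_def)
  have MQ: "M ms \<in> QTSASM n" if "alternating_quarter K (antidiagonal h @ ms)" "\<forall>(s, i, j)\<in>set ms. i \<le> k" for ms
    unfolding M_def
    by (rule alternating_quarter_QTSASM[OF that(1) _ k(1) kK(2) K(2)]) (use that(2) base_rows in auto)
  let ?B = "[(-1, 1, h), (-1, 2, K), (1, h, K), (1, 1, K), (1, 2, 2), (-1, 2, K)]"
  have notin: "(1, i) \<notin> A" "(2, K) \<notin> A" "(h, K) \<notin> A" "(i, 1) \<notin> A" for i
    using bound[of 1 i] bound[of 2 K] bound[of h K] bound[of i 1] kK(2) h3 by auto
  have corner: "(2, 2) \<in> A" using A by (simp add: young_diagrams_def)
  have hk: "h \<le> k" "2 \<le> k" using h3 Kh kK by auto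
  have BQ: "M ?B \<in> QTSASM n"
    by (rule MQ[OF quarter_corner[OF Kh h3]]) (use hk in auto)
  obtain g :: "real_matrix \<Rightarrow> real" and c where g: "linear g"
    "\<And>X. X \<in> QTSASM n \<Longrightarrow> f X = 0 \<Longrightarrow> g X = c" "c < g (M ?B)"
    "is_facet_of {X \<in> convex hull QTSASM n. g X = c} (convex hull QTSASM n)"
  \<comment> \<open>The base matrix is tight, and the corner matrix has diagram sum 1. Keeping the
    latter off the facet yields \<open>pos\<close>.\<close>
  proof (rule facet_through_tight_points[of "QTSASM n" f 0 "M []" "M ?B"])
    show "linear f" unfolding f_def by (rule linear_sum_lookup)
    show "0 \<le> f X" if "X \<in> QTSASM n" for X
      unfolding f_def using diagram_sum_nonneg[OF that] A k(1) by simp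
    show "M [] \<in> QTSASM n" by (rule MQ[OF quarter_antidiagonal[OF Kh h3]]) simp
    show "f (M []) = 0" by (simp add: fM)
    show "0 < f (M ?B)" using notin corner by (simp add: fM)
  qed (use finite_QTSASM BQ in blast)+
  define F where "F = {X \<in> convex hull QTSASM n. g X = c}"
  have "M [] \<in> QTSASM n" by (rule MQ[OF quarter_antidiagonal[OF Kh h3]]) simp
  then have "g (M []) = c" by (intro g(2)) (simp_all add: fM)
  then have gM: "g (M ms) = c + (\<Sum>(s, i, j)\<leftarrow>ms. s * cell_weight n g i j)" for ms
    using linear_unfold_sparse_append[OF g(1), of n "antidiagonal h" ms] by (simp add: M_def)
  have "0 < (\<Sum>(s, i, j)\<leftarrow>?B. s * cell_weight n g i j)" using g(3) by (simp only: gM)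
  then have pos: "0 < - cell_weight n g 1 h - cell_weight n g 2 K + cell_weight n g h K +
      cell_weight n g 1 K + cell_weight n g 2 2 - cell_weight n g 2 K" by simp
  have tight: "(\<Sum>(s, i, j)\<leftarrow>ms. s * cell_weight n g i j) = 0"
    if "alternating_quarter K (antidiagonal h @ ms)" "\<forall>(s, i, j)\<in>set ms. i \<le> k"
      "(\<Sum>(s, i, j)\<leftarrow>ms. if (i, j) \<in> A then s else 0) = 0" for ms
    using g(2)[OF MQ[OF that(1,2)]] that(3) by (simp only: gM fM) simp
  let ?w = "cell_weight n g"
  have det_col: "(i, 2) \<in> A \<longleftrightarrow> - ?w 1 h - ?w 2 K + ?w h K + ?w i 1 + ?w 2 2 - ?w i 2 = 0"
    if "3 \<le> i" "i + 2 \<le> k + 1" for i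
    by (rule weights_determine_diagram(1)[OF Kh h3 kK(1) A _ pos that]) (rule tight)
  have det_row: "(i, j) \<in> A \<longleftrightarrow> - ?w 1 h - ?w 2 K + ?w h K + ?w 1 j + ?w i 2 - ?w i j = 0"
    if "2 \<le> i" "3 \<le> j" "i + j \<le> k + 1" "(i, 2) \<in> A" for i j
    by (rule weights_determine_diagram(2)[OF Kh h3 kK(1) A _ pos that]) (rule tight)
  have F_iff: "M ms \<in> F \<longleftrightarrow> (\<Sum>(s, i, j)\<leftarrow>ms. s * cell_weight n g i j) = 0"
    if "alternating_quarter K (antidiagonal h @ ms)" "\<forall>(s, i, j)\<in>set ms. i \<le> k" for ms
    using MQ[OF that] by (simp add: F_def gM hull_inc)
  have col: "(i, 2) \<in> A \<longleftrightarrow> column_link n h K i \<in> F" if i: "3 \<le> i" "i + 2 \<le> k + 1" for i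
  proof -
    have "i < K" using i kK by linarith
    then show ?thesis
      unfolding column_link_def M_def[symmetric]
      using F_iff[OF quarter_column_link[OF Kh h3 i(1)]] det_col[OF i] i hk by auto
  qed
  have row: "(i, j) \<in> A \<longleftrightarrow> row_link n h K i j \<in> F"
    if ij: "2 \<le> i" "3 \<le> j" "i + j \<le> k + 1" "(i, 2) \<in> A" for i j
  proof -
    have "i + j < 2 * h" using ij kK Kh by linarith
    then show ?thesis
      unfolding row_link_def M_def[symmetric]
      using F_iff[OF quarter_row_link[OF Kh h3 ij(1,2)]] det_row[OF ij] ij hk by auto
  qed
  show ?thesis
  proof (intro exI[of _ F] conjI allI impI)
    show "is_facet_of F (P_QTSASM n)" using g(4) by (simp add: F_def P_QTSASM_def)
    fix i j :: nat assume ij: "2 \<le> i" "2 \<le> j" "i + j \<le> k + 1"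
    have "(i, 2) \<in> A" if "(i, j) \<in> A"
      using A that ij unfolding young_diagrams_def by blast
    moreover have "(i, 2) \<in> A \<longleftrightarrow> i = 2 \<or> column_link n h K i \<in> F"
      using col[of i] corner ij by (cases "i = 2") auto
    moreover have "(i, j) \<in> A \<longleftrightarrow> j = 2 \<or> row_link n h K i j \<in> F" if "(i, 2) \<in> A"
      using row[of i j] that ij by (cases "j = 2") auto
    ultimately show "(i, j) \<in> A \<longleftrightarrow>
        (i = 2 \<or> column_link n h K i \<in> F) \<and> (j = 2 \<or> row_link n h K i j \<in> F)" by blast
  qed
qed

lemma num_facets_ge_Cat:
  assumes n: "4 \<le> n" "n mod 4 \<noteq> 2" and k: "k = n div 2"
  shows "Cat (k - 1) - 1 \<le> real (num_facets (P_QTSASM n))"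
proof (cases "k = 2")
  case True
  \<comment> \<open>Here the claimed bound is 0.\<close>
  then show ?thesis by (simp add: Cat_def)
next
  case False
  then have k3: "3 \<le> k" using n k by linarith
  define K where "K = (if even k then k else k + 1)"
  define h where "h = K div 2 + 1"
  \<comment> \<open>The residue of \<open>n\<close> enters here: for odd \<open>k\<close> it
    excludes \<open>n = 2 * k\<close>, so \<open>n = 2 * k + 1\<close> and a central column
    exists.\<close>
  have "K \<le> n - k"
  proof (cases "even k")
    case False
    then have "n \<noteq> 2 * k" using n(2) by presburger
    then show ?thesis using False k by (simp add: K_def)
  qed (use k in \<open>simp add: K_def\<close>)
  note facet = facet_of_young_diagram[OF k k3 K_def this h_def]
  have "\<exists>F. \<forall>A\<in>young_diagrams k. is_facet_of (F A) (P_QTSASM n) \<and>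
    (\<forall>i j. 2 \<le> i \<longrightarrow> 2 \<le> j \<longrightarrow> i + j \<le> k + 1 \<longrightarrow> ((i, j) \<in> A \<longleftrightarrow>
      (i = 2 \<or> column_link n h K i \<in> F A) \<and> (j = 2 \<or> row_link n h K i j \<in> F A)))"
    by (rule bchoice) (intro ballI facet)
  then obtain F where F: "\<And>A. A \<in> young_diagrams k \<Longrightarrow> is_facet_of (F A) (P_QTSASM n)"
    "\<And>A i j. A \<in> young_diagrams k \<Longrightarrow> 2 \<le> i \<Longrightarrow> 2 \<le> j \<Longrightarrow> i + j \<le> k + 1 \<Longrightarrow> (i, j) \<in> A \<longleftrightarrow>
      (i = 2 \<or> column_link n h K i \<in> F A) \<and> (j = 2 \<or> row_link n h K i j \<in> F A)"
    by blast
  have "inj_on F (young_diagrams k)"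
  proof (rule inj_onI)
    fix A B assume AB: "A \<in> young_diagrams k" "B \<in> young_diagrams k" "F A = F B"
    have "p \<in> A \<longleftrightarrow> p \<in> B" for p
    proof (cases p)
      case (Pair i j)
      show ?thesis
      proof (cases "2 \<le> i \<and> 2 \<le> j \<and> i + j \<le> k + 1")
        case True
        then show ?thesis using F(2)[OF AB(1), of i j] F(2)[OF AB(2), of i j] AB(3) Pair by simp
      next
        case False
        then show ?thesis
          using young_diagram_notin[OF AB(1), of i j] young_diagram_notin[OF AB(2), of i j] Pair by auto
      qed
    qed
    then show "A = B" by blast
  qed
  moreover have "F ` young_diagrams k \<subseteq> {F. is_facet_of F (P_QTSASM n)}" using F(1) by auto
  moreover have "finite {F. is_facet_of F (P_QTSASM n)}"
    unfolding P_QTSASM_def by (rule finite_facets_convex_hull[OF finite_QTSASM])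
  ultimately have "card (young_diagrams k) \<le> num_facets (P_QTSASM n)"
    unfolding num_facets_def by (rule card_inj_on_le)
  then show ?thesis using card_young_diagrams[of k] by linarith
qed

section \<open>Exponential lower bounds\<close>

lemma Cat_ge:
  assumes "2 \<le> k"
  shows "4 ^ (k - 1) / (real k * (2 * real k - 1)) \<le> Cat (k - 1)"
proof -
  define m where "m = k - 1"
  have m: "m > 0" "k = m + 1" using assms by (auto simp: m_def)
  have "4 ^ m / (2 * real m + 1) \<le> 4 ^ m / (2 * real m)"
    using m by (intro divide_left_mono) auto
  also have "\<dots> \<le> real ((2 * m) choose m)" by (rule central_binomial_lower_bound[OF m(1)])
  finally have "4 ^ m / (2 * real m + 1) / (real m + 1) \<le> real ((2 * m) choose m) / (real m + 1)"
    by (rule divide_right_mono) simp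
  then show ?thesis by (simp add: m Cat_def mult.commute algebra_simps)
qed

lemma power_ratio_bound:
  assumes n: "4 \<le> n" and k: "k = n div 2"
  shows "2 ^ (n - 3) / (real n)\<^sup>2 \<le> 4 ^ (k - 1) / (real k * (2 * real k - 1))"
proof (rule frac_le)
  \<comment> \<open>The exponents compare because \<open>n \<le> 2 * k + 1\<close>.\<close>
  have "(2::real) ^ (n - 3) \<le> 2 ^ (2 * (k - 1))" using n k by (intro power_increasing) auto
  then show "(2::real) ^ (n - 3) \<le> 4 ^ (k - 1)" by (simp add: power_mult)
  have k2: "2 \<le> k" "2 * k \<le> n" using n k by auto
  then show "0 < real k * (2 * real k - 1)" by simp
  have "real k * (2 * real k - 1) \<le> (2 * real k) * (2 * real k)"
    by (intro mult_mono) (use k2 in auto)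
  also have "\<dots> \<le> real n * real n" using k2 by (intro mult_mono) auto
  finally show "real k * (2 * real k - 1) \<le> (real n)\<^sup>2" by (simp add: power2_eq_square)
qed simp

theorem proposition6p29:
  shows "(\<forall>n k :: nat. n \<ge> 4 \<and> n mod 4 \<noteq> 2 \<and> k = n div 2 \<longrightarrow>
            real (num_facets (P_QTSASM n)) \<ge> Cat (k - 1) - 1 \<and>
            Cat (k - 1) - 1 = 1 / real k * real ((2 * k - 2) choose (k - 1)) - 1 \<and>
            real (num_facets (P_QTSASM n)) \<ge> 4 ^ (k - 1) / (real k * (2 * real k - 1)) - 1 \<and>
            4 ^ (k - 1) / (real k * (2 * real k - 1)) - 1 \<ge> 2 ^ (n - 3) / (real n)\<^sup>2 - 1)
       \<and> (\<exists>c::real. c > 0 \<and>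
            (\<forall>\<^sub>F n in sequentially. n mod 4 \<noteq> 2 \<longrightarrow>
               real (num_facets (P_QTSASM n)) \<ge> 2 powr (c * real n)))"
proof
  have bound: "real (num_facets (P_QTSASM n)) \<ge> Cat (k - 1) - 1 \<and>
      Cat (k - 1) - 1 = 1 / real k * real ((2 * k - 2) choose (k - 1)) - 1 \<and>
      real (num_facets (P_QTSASM n)) \<ge> 4 ^ (k - 1) / (real k * (2 * real k - 1)) - 1 \<and>
      4 ^ (k - 1) / (real k * (2 * real k - 1)) - 1 \<ge> 2 ^ (n - 3) / (real n)\<^sup>2 - 1"
    if n: "4 \<le> n" "n mod 4 \<noteq> 2" "k = n div 2" for n k
  proof -
    have k2: "2 \<le> k" using n by auto
    then have "2 * (k - 1) = 2 * k - 2" "real (k - 1) + 1 = real k" by auto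
    then have "Cat (k - 1) = 1 / real k * real ((2 * k - 2) choose (k - 1))"
      by (simp only: Cat_def)
    then show ?thesis
      using num_facets_ge_Cat[OF n] Cat_ge[OF k2] power_ratio_bound[OF n(1,3)] by linarith
  qed
  then show "\<forall>n k :: nat. n \<ge> 4 \<and> n mod 4 \<noteq> 2 \<and> k = n div 2 \<longrightarrow>
            real (num_facets (P_QTSASM n)) \<ge> Cat (k - 1) - 1 \<and>
            Cat (k - 1) - 1 = 1 / real k * real ((2 * k - 2) choose (k - 1)) - 1 \<and>
            real (num_facets (P_QTSASM n)) \<ge> 4 ^ (k - 1) / (real k * (2 * real k - 1)) - 1 \<and>
            4 ^ (k - 1) / (real k * (2 * real k - 1)) - 1 \<ge> 2 ^ (n - 3) / (real n)\<^sup>2 - 1"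
    by blast
  \<comment> \<open>Any positive constant below 1 could replace 1 / 2.\<close>
  have "\<forall>\<^sub>F n in sequentially. 2 powr (1 / 2 * real n) \<le> 2 ^ n / 8 / (real n)\<^sup>2 - 1"
    by real_asymp
  then have "\<forall>\<^sub>F n in sequentially. n mod 4 \<noteq> 2 \<longrightarrow>
      2 powr (1 / 2 * real n) \<le> real (num_facets (P_QTSASM n))"
    using eventually_ge_at_top[of 4]
  proof eventually_elim
    case (elim n)
    have "(2::real) ^ n = 2 ^ (n - 3) * 2 ^ 3"
      unfolding power_add[symmetric] using elim(2) by simp
    then have "2 ^ n / 8 = (2::real) ^ (n - 3)" by simp
    then show ?case using bound[OF elim(2) _ refl] elim(1) by fastforce
  qed
  then show "\<exists>c::real. c > 0 \<and> (\<forall>\<^sub>F n in sequentially. n mod 4 \<noteq> 2 \<longrightarrow>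
      real (num_facets (P_QTSASM n)) \<ge> 2 powr (c * real n))"
    by (intro exI[of _ "1 / 2"]) simp
qed

end
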